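(* Let $(R,\mathfrak{m},k)$ be a regular local ring of Krull dimension $3$. Let $x_1,x_2,x_3$ be a regular system of parameters in $R$ and let $a,b\in\mathbb{N}^3$. Let $I$ be the HN ideal associated to $x_1,x_2,x_3$ and $a,b$. If $\gcd(m(a,b))=1$, then $I$ is prime. In particular, $R$ is not a Shimoda ring.
   Context: $\mathbb{N}$ denotes the positive integers. Let $a=(a_1,a_2,a_3)$, $b=(b_1,b_2,b_3)\in\mathbb{N}^3$ and $c=(c_1,c_2,c_3)=a+b$. The HN (Herzog–Northcott) ideal associated to $x_1,x_2,x_3$ and $a,b$ is the ideal $I=(v_1,v_2,D)$ of $R$, where $v_1=x_1^{c_1}-x_2^{b_2}x_3^{a_3}$, $v_2=x_2^{c_2}-x_1^{a_1}x_3^{b_3}$ and $D=x_3^{c_3}-x_1^{b_1}x_2^{a_2}$; equivalently, $I$ is generated by the $2\times 2$ minors of the matrix $$\begin{pmatrix} x_1^{a_1}&x_2^{a_2}&x_3^{a_3}\\ x_2^{b_2}&x_3^{b_3}&x_1^{b_1}\end{pmatrix}.$$ Set $m_1=c_2c_3-a_2b_3$, $m_2=c_1c_3-a_3b_1$, $m_3=c_1c_2-a_1b_2$ and $m(a,b)=(m_1,m_2,m_3)\in\mathbb{N}^3$; $\gcd(m(a,b))$ means $\gcd(m_1,m_2,m_3)$. A Noetherian local ring $(R,\mathfrak{m},k)$ of Krull dimension $\geq 1$ is called a Shimoda ring if every prime ideal $\mathfrak{p}\neq\mathfrak{m}$ of $R$ satisfies $\mu(\mathfrak{p})=\mathrm{height}(\mathfrak{p})$,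 where $\mu$ denotes the minimal number of generators. *)

theory Defs
  imports "HOL-Algebra.Algebra" "HOL-Library.Extended_Nat"
begin

section \<open>Dimension theory of commutative rings\<close>

text \<open>Strict chains of prime ideals \<open>p 0 \<subset> p 1 \<subset> \<dots> \<subset> p n\<close>; the length of such a chain is \<open>n\<close>,
  the number of inclusions. Values of \<open>p\<close> beyond \<open>n\<close> are irrelevant.\<close>

definition prime_chain :: "('a, 'b) ring_scheme \<Rightarrow> nat \<Rightarrow> (nat \<Rightarrow> 'a set) \<Rightarrow> bool" where
  "prime_chain R n p \<longleftrightarrow> (\<forall>i\<le>n. primeideal (p i) R) \<and> (\<forall>i<n. p i \<subset> p (Suc i))"

text \<open>Suprema and infima are taken in \<^typ>\<open>enat\<close>; the zero ring gets dimension \<open>0\<close>.\<close>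

definition krull_dim :: "('a, 'b) ring_scheme \<Rightarrow> enat" where
  "krull_dim R = Sup {enat n | n. \<exists>p. prime_chain R n p}"

definition ideal_height :: "('a, 'b) ring_scheme \<Rightarrow> 'a set \<Rightarrow> enat" where
  "ideal_height R P = Sup {enat n | n. \<exists>p. prime_chain R n p \<and> p n = P}"
  \<comment> \<open>intended for prime ideals \<open>P\<close> only\<close>

text \<open>The minimal number of generators \<open>\<mu>(I)\<close>; it is \<open>\<infinity>\<close> if \<open>I\<close> is not finitely generated.\<close>

definition min_gens :: "('a, 'b) ring_scheme \<Rightarrow> 'a set \<Rightarrow> enat" where
  "min_gens R I = Inf {enat (card A) | A. A \<subseteq> carrier R \<and> finite A \<and> I = Idl\<^bsub>R\<^esub> A}"

section \<open>Regular local rings and Shimoda rings\<close>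

locale noetherian_local_ring = cring R + noetherian_ring R
  for R (structure) and \<mm> +
  assumes maximal: "maximalideal \<mm> R"
    and maximal_unique: "maximalideal J R \<Longrightarrow> J = \<mm>"

locale regular_local_ring = noetherian_local_ring +
  assumes regular: "min_gens R \<mm> = krull_dim R"

definition (in noetherian_local_ring) regular_system_of_parameters :: "'a list \<Rightarrow> bool" where
  "regular_system_of_parameters xs \<longleftrightarrow>
     set xs \<subseteq> carrier R \<and> enat (length xs) = krull_dim R \<and> Idl (set xs) = \<mm>"

locale shimoda_ring = noetherian_local_ring +
  assumes dim_ge_1: "krull_dim R \<ge> 1"
    and min_gens_eq_height:
      "\<lbrakk>primeideal P R; P \<noteq> \<mm>\<rbrakk> \<Longrightarrow> min_gens R P = ideal_height R P"

section \<open>Herzog--Northcott ideals\<close>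

text \<open>The ideal \<open>(v\<^sub>1, v\<^sub>2, D)\<close>, where \<open>c = a + b\<close>.\<close>

fun HN_ideal :: "('a, 'b) ring_scheme \<Rightarrow> 'a \<times> 'a \<times> 'a \<Rightarrow> nat \<times> nat \<times> nat \<Rightarrow> nat \<times> nat \<times> nat \<Rightarrow> 'a set"
where
  "HN_ideal R (x1, x2, x3) (a1, a2, a3) (b1, b2, b3) =
    (let c1 = a1 + b1; c2 = a2 + b2; c3 = a3 + b3;
         v1 = x1 [^]\<^bsub>R\<^esub> c1 \<ominus>\<^bsub>R\<^esub> x2 [^]\<^bsub>R\<^esub> b2 \<otimes>\<^bsub>R\<^esub> x3 [^]\<^bsub>R\<^esub> a3;
         v2 = x2 [^]\<^bsub>R\<^esub> c2 \<ominus>\<^bsub>R\<^esub> x1 [^]\<^bsub>R\<^esub> a1 \<otimes>\<^bsub>R\<^esub> x3 [^]\<^bsub>R\<^esub> b3;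
         D  = x3 [^]\<^bsub>R\<^esub> c3 \<ominus>\<^bsub>R\<^esub> x1 [^]\<^bsub>R\<^esub> b1 \<otimes>\<^bsub>R\<^esub> x2 [^]\<^bsub>R\<^esub> a2
     in Idl\<^bsub>R\<^esub> {v1, v2, D})"

text \<open>The triple \<open>m(a, b)\<close>. The subtraction on \<^typ>\<open>nat\<close> never truncates,
  since \<open>a\<^sub>i \<le> c\<^sub>i\<close> and \<open>b\<^sub>i \<le> c\<^sub>i\<close>.\<close>

fun HN_m :: "nat \<times> nat \<times> nat \<Rightarrow> nat \<times> nat \<times> nat \<Rightarrow> nat \<times> nat \<times> nat" where
  "HN_m (a1, a2, a3) (b1, b2, b3) =
    (let c1 = a1 + b1; c2 = a2 + b2; c3 = a3 + b3
     in (c2 * c3 - a2 * b3, c1 * c3 - a3 * b1, c1 * c2 - a1 * b2))"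

end

theory Submission
  imports Defs
begin

text \<open>Write \<open>x, y, z\<close> for the parameters, \<open>v1, v2, D\<close> for the generators of \<open>I\<close>, and give \<open>x, y, z\<close> the
weights \<open>m1, m2, m3\<close>. Each generator is a difference of two monomials of the same weight. Used as
rewrite rules, the generators turn every monomial, modulo \<open>I\<close>, into a monomial \<open>x^i y^j z^l\<close> of the
same weight whose pair \<open>(j, l)\<close> lies in the staircase below \<open>y^c2\<close>, \<open>z^c3\<close> and \<open>y^b2 z^a3\<close>. This
staircase has exactly \<open>m1\<close> cells, and if the gcd is \<open>1\<close> the weights of its cells meet all residue
classes modulo \<open>m1\<close>. So they meet each class once, a weight has at most one reduced monomial, and all
monomials of equal weight agree modulo \<open>I\<close> (\<open>reduced_weight_unique\<close>).

Let \<open>F n\<close> be generated by \<open>I\<close> and the monomials of weight at least \<open>n\<close>. Every element outside \<open>I\<close>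
is then, modulo some \<open>F (n + 1)\<close>, a unit times a single monomial of weight \<open>n\<close>
(\<open>leading_monomial\<close>): the graded ring of \<open>R / I\<close> looks like a monomial curve. The product of two such
elements has the product monomial as leading term, so it is not in \<open>I\<close>. For this to work, a monomial of weight
\<open>n\<close> must stay outside \<open>F (n + 1)\<close>, and the intersection of the \<open>F n\<close> must be \<open>I\<close>. Both follow from
\<open>F_colon_x\<close>: \<open>x f \<in> F n\<close> implies \<open>f \<in> F (n - m1)\<close>. This in turn needs that \<open>x\<close> is regular modulo
\<open>I\<close>, which is read off from the two rows of the defining matrix (\<open>I_x_regular\<close>), and that
\<open>y^j z^l\<close> is not in \<open>(x, y^(j+1), z^(l+1))\<close>.

The last two facts hold for every regular sequence \<open>x, y, z\<close> that generates the maximal ideal. That parameters of a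
regular local ring form such a sequence comes from dimension theory: by Krull's principal ideal
theorem a chain of primes can be rerouted through a given element, so chains above \<open>J\<close> are no longer
than the number of elements that must be added to \<open>J\<close> to generate the maximal ideal; and if some
chain attains this length, then \<open>J\<close> is prime (\<open>parameters_prime\<close>). Ideals that are saturated with
respect to a prime take the place of ideals in a localization throughout.

For the failure of the Shimoda property, take \<open>a = (1, 1, 1)\<close> and \<open>b = (2, 1, 1)\<close>, with weights
\<open>3, 4, 5\<close>. The prime \<open>I\<close> has height at most \<open>2\<close> because it is strictly below the maximal ideal, but
all syzygies of its three generators have coefficients in the maximal ideal, so two elements do not
generate it (\<open>I_not_two_generated\<close>).\<close>

section \<open>Adjoining an element to an ideal\<close>

locale noetherian_cring = cring R + noetherian_ring R for R (structure)

sublocale noetherian_local_ring \<subseteq> noetherian_cring ..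

lemma (in ring) ideal_minus_closed:
  assumes "ideal J R" "a \<in> J" "b \<in> J" shows "a \<ominus> b \<in> J"
proof -
  interpret ideal J R by fact
  show ?thesis using assms(2,3) by (simp add: a_minus_def)
qed

lemma (in ring) ideal_add_closed:
  assumes "ideal J R" "a \<in> J" "b \<in> J" shows "a \<oplus> b \<in> J"
proof -
  interpret ideal J R by fact
  show ?thesis using assms(2,3) by simp
qed

lemma (in cring) one_notin_proper_ideal:
  assumes "ideal J R" "J \<noteq> carrier R" shows "\<one> \<notin> J"
  using assms ideal.one_imp_carrier by blast

text \<open>The ideal \<open>J + (a)\<close>, with its elements written out because their coefficients are what the
proofs compute with.\<close>

definition adjoin :: "('a, 'b) ring_scheme \<Rightarrow> 'a set \<Rightarrow> 'a \<Rightarrow> 'a set" where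
  "adjoin R J a = {j \<oplus>\<^bsub>R\<^esub> r \<otimes>\<^bsub>R\<^esub> a | j r. j \<in> J \<and> r \<in> carrier R}"

context cring
begin

lemma adjoin_eq_set_add: "a \<in> carrier R \<Longrightarrow> adjoin R J a = J <+>\<^bsub>R\<^esub> PIdl a"
  unfolding adjoin_def set_add_def' cgenideal_def by blast

lemma adjoin_ideal: "ideal J R \<Longrightarrow> a \<in> carrier R \<Longrightarrow> ideal (adjoin R J a) R"
  by (simp add: adjoin_eq_set_add add_ideals cgenideal_ideal)

lemma adjoin_superset: assumes "ideal J R" "a \<in> carrier R" shows "J \<subseteq> adjoin R J a"
proof
  fix j assume j: "j \<in> J"
  then have "j = j \<oplus> \<zero> \<otimes> a" using assms ideal.Icarr[OF assms(1)] by simp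
  then show "j \<in> adjoin R J a" using j unfolding adjoin_def by blast
qed

lemma adjoin_self: assumes "ideal J R" "a \<in> carrier R" shows "a \<in> adjoin R J a"
proof -
  have "a = \<zero> \<oplus> \<one> \<otimes> a" using assms by simp
  moreover have "\<zero> \<in> J" using assms(1) by (simp add: additive_subgroup.zero_closed ideal_def)
  ultimately show ?thesis unfolding adjoin_def by blast
qed

lemma adjoin_minimal:
  assumes "ideal L R" "J \<subseteq> L" "a \<in> L" shows "adjoin R J a \<subseteq> L"
proof -
  interpret ideal L R by fact
  show ?thesis using assms(2,3) unfolding adjoin_def by (auto intro!: I_l_closed)
qed

lemma adjoin_Idl: assumes "S \<subseteq> carrier R" "a \<in> carrier R" shows "Idl (insert a S) = adjoin R (Idl S) a"
proof
  have I: "ideal (Idl S) R" using assms(1) by (rule genideal_ideal)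
  have "insert a S \<subseteq> adjoin R (Idl S) a"
    using adjoin_superset[OF I assms(2)] adjoin_self[OF I assms(2)] genideal_self[OF assms(1)] by simp
  then show "Idl (insert a S) \<subseteq> adjoin R (Idl S) a"
    by (rule genideal_minimal[OF adjoin_ideal[OF I assms(2)]])
  have c: "insert a S \<subseteq> carrier R" using assms by simp
  have "Idl S \<subseteq> Idl (insert a S)" by (rule subset_Idl_subset[OF c]) blast
  then show "adjoin R (Idl S) a \<subseteq> Idl (insert a S)"
    using genideal_self[OF c] by (intro adjoin_minimal[OF genideal_ideal[OF c]]) auto
qed

lemma adjoinE:
  assumes "r \<in> adjoin R J a" obtains j t where "j \<in> J" "t \<in> carrier R" "r = j \<oplus> t \<otimes> a"
  using assms unfolding adjoin_def by blast

lemma adjoinI: "j \<in> J \<Longrightarrow> t \<in> carrier R \<Longrightarrow> j \<oplus> t \<otimes> a \<in> adjoin R J a"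
  unfolding adjoin_def by blast

lemma adjoin_diffI:
  assumes "ideal J R" "r \<in> carrier R" "t \<in> carrier R" "a \<in> carrier R" "r \<ominus> t \<otimes> a \<in> J"
  shows "r \<in> adjoin R J a"
proof -
  have "r = (r \<ominus> t \<otimes> a) \<oplus> t \<otimes> a" using assms(2-4) by algebra
  then show ?thesis using adjoinI[OF assms(5,3), of a] by simp
qed

lemma cgenidealE:
  assumes "r \<in> PIdl a" obtains t where "t \<in> carrier R" "r = t \<otimes> a"
  using assms unfolding cgenideal_def by blast

lemma cgenidealI: "t \<in> carrier R \<Longrightarrow> t \<otimes> a \<in> PIdl a"
  unfolding cgenideal_def by blast

end

section \<open>Saturated ideals and Nakayama's lemma\<close>

context cring
begin

text \<open>Ideals saturated with respect to a prime \<open>Q\<close> correspond to the ideals of the localization at \<open>Q\<close>;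
they let arguments at \<open>Q\<close> take place inside \<open>R\<close>.\<close>

definition saturated :: "'a set \<Rightarrow> 'a set \<Rightarrow> bool" where
  "saturated Q J \<longleftrightarrow> (\<forall>s\<in>carrier R - Q. \<forall>r\<in>carrier R. s \<otimes> r \<in> J \<longrightarrow> r \<in> J)"

definition saturation :: "'a set \<Rightarrow> 'a set \<Rightarrow> 'a set" where
  "saturation Q J = {r \<in> carrier R. \<exists>s\<in>carrier R - Q. s \<otimes> r \<in> J}"

lemma saturatedD:
  "saturated Q J \<Longrightarrow> s \<in> carrier R \<Longrightarrow> s \<notin> Q \<Longrightarrow> r \<in> carrier R \<Longrightarrow> s \<otimes> r \<in> J \<Longrightarrow> r \<in> J"
  unfolding saturated_def by blast

lemma prime_not_mult:
  assumes "primeideal Q R" "s \<in> carrier R - Q" "t \<in> carrier R - Q"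
  shows "s \<otimes> t \<in> carrier R - Q"
  using assms primeideal.I_prime by fastforce

lemma prime_one_not: assumes "primeideal Q R" shows "\<one> \<in> carrier R - Q"
  using assms one_notin_proper_ideal[of Q] by (auto simp: primeideal_def primeideal_axioms_def)

lemma saturation_superset:
  assumes "primeideal Q R" "ideal J R" shows "J \<subseteq> saturation Q J"
  using prime_one_not[OF assms(1)] ideal.Icarr[OF assms(2)] unfolding saturation_def
  by (auto intro!: bexI[of _ \<one>])

lemma saturation_ideal:
  assumes Q: "primeideal Q R" and J: "ideal J R" shows "ideal (saturation Q J) R"
proof (rule idealI[OF ring_axioms])
  interpret J: ideal J R by fact
  show "subgroup (saturation Q J) (add_monoid R)"
  proof (rule group.subgroupI)
    show "group (add_monoid R)" by (rule add.is_group)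
    show "saturation Q J \<subseteq> carrier (add_monoid R)" unfolding saturation_def by auto
    show "saturation Q J \<noteq> {}" using saturation_superset[OF assms] J.zero_closed by blast
    fix a assume "a \<in> saturation Q J"
    then obtain s where s: "a \<in> carrier R" "s \<in> carrier R - Q" "s \<otimes> a \<in> J"
      unfolding saturation_def by blast
    then have "s \<otimes> (\<ominus> a) \<in> J" using J.a_inv_closed[OF s(3)] by (simp add: r_minus)
    then show "inv\<^bsub>add_monoid R\<^esub> a \<in> saturation Q J"
      using s unfolding saturation_def a_inv_def[symmetric] by auto
    fix b assume "b \<in> saturation Q J"
    then obtain t where t: "b \<in> carrier R" "t \<in> carrier R - Q" "t \<otimes> b \<in> J"
      unfolding saturation_def by blast
    have sc: "s \<in> carrier R" and tc: "t \<in> carrier R" using s t by auto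
    have "s \<otimes> t \<otimes> (a \<oplus> b) = t \<otimes> (s \<otimes> a) \<oplus> s \<otimes> (t \<otimes> b)" using s(1) sc t(1) tc by algebra
    also have "\<dots> \<in> J" using J.I_l_closed[OF s(3) tc] J.I_l_closed[OF t(3) sc] by simp
    finally show "a \<otimes>\<^bsub>add_monoid R\<^esub> b \<in> saturation Q J"
      using s t prime_not_mult[OF Q s(2) t(2)] unfolding saturation_def by auto
  qed
next
  interpret J: ideal J R by fact
  fix a r assume "a \<in> saturation Q J" and r: "r \<in> carrier R"
  then obtain s where s: "a \<in> carrier R" "s \<in> carrier R - Q" "s \<otimes> a \<in> J"
      unfolding saturation_def by blast
  have "s \<otimes> (r \<otimes> a) = r \<otimes> (s \<otimes> a)" using s r m_lcomm by auto
  also have "\<dots> \<in> J" using J.I_l_closed[OF s(3) r] .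
  finally have "s \<otimes> (r \<otimes> a) \<in> J" .
  then show "r \<otimes> a \<in> saturation Q J" using s r unfolding saturation_def by auto
  then show "a \<otimes> r \<in> saturation Q J" using s r m_comm by simp
qed

lemma saturation_saturated:
  assumes Q: "primeideal Q R" shows "saturated Q (saturation Q J)"
  unfolding saturated_def
proof (intro ballI impI)
  fix s r assume s: "s \<in> carrier R - Q" and r: "r \<in> carrier R" and "s \<otimes> r \<in> saturation Q J"
  then obtain t where t: "t \<in> carrier R - Q" "t \<otimes> (s \<otimes> r) \<in> J" unfolding saturation_def by blast
  then have "t \<otimes> s \<otimes> r \<in> J" using s r by (simp add: m_assoc)
  then show "r \<in> saturation Q J" using prime_not_mult[OF Q t(1) s] r unfolding saturation_def by blast
qed

lemma saturated_mono: "saturated P J \<Longrightarrow> P \<subseteq> Q \<Longrightarrow> saturated Q J"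
  unfolding saturated_def by blast

lemma saturation_adjoinE:
  assumes "r \<in> saturation Q (adjoin R J a)"
  obtains s j t where "s \<in> carrier R" "s \<notin> Q" "j \<in> J" "t \<in> carrier R" "s \<otimes> r = j \<oplus> t \<otimes> a"
  using assms unfolding saturation_def adjoin_def by blast

lemma colon_ideal:
  assumes "ideal L R" "g \<in> carrier R" shows "ideal {r \<in> carrier R. r \<otimes> g \<in> L} R"
proof -
  have "{r \<in> carrier R. r \<otimes> g \<in> L} = {r \<in> carrier R. g \<otimes> r \<in> L}" using assms m_comm by auto
  then show ?thesis using ideal.helper_max_prime[OF assms(1) is_cring assms(2)] by simp
qed

end

context noetherian_cring
begin

text \<open>The maximum condition, by Zorn's lemma: the union of a chain of ideals is a member of the chain.\<close>

lemma maximal_ideal_in_family: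
  assumes "\<And>J. J \<in> F \<Longrightarrow> ideal J R" "F \<noteq> {}"
  shows "\<exists>M\<in>F. \<forall>J\<in>F. M \<subseteq> J \<longrightarrow> J = M"
proof -
  have "\<exists>U\<in>F. \<forall>Y\<in>C. Y \<subseteq> U" if C: "subset.chain F C" for C
  proof (cases "C = {}")
    case True
    then show ?thesis using assms(2) by auto
  next
    case False
    have "subset.chain {I. ideal I R} C"
      using C assms(1) unfolding pred_on.chain_def by blast
    then have "\<Union>C \<in> C" using ideal_chain_is_trivial[OF False] by blast
    then show ?thesis
      using C by (intro bexI[of _ "\<Union>C"]) (auto simp: pred_on.chain_def)
  qed
  then show ?thesis by (rule subset_Zorn)
qed

text \<open>Nakayama's lemma at the prime \<open>Q\<close>. The hypothesis \<open>step\<close> says that locally \<open>M\<close> is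
contained in \<open>K + Q M\<close>; the sum is replaced by all ideals \<open>L\<close> above \<open>K\<close> and \<open>Q M\<close>.
The proof uses the maximum condition instead of determinants: for a saturated \<open>J\<close> maximal among those
that contain \<open>K\<close> but not \<open>M\<close>, any product \<open>q m\<close> outside \<open>J\<close> would force \<open>s m = j + t q m\<close> with \<open>s\<close>
outside \<open>Q\<close>, and cancelling \<open>s - t q\<close> gives \<open>m \<in> J\<close>. So \<open>Q M\<close> is contained in \<open>J\<close>.\<close>

lemma nakayama_saturated:
  assumes Q: "primeideal Q R" and M: "ideal M R" and K: "ideal K R" "saturated Q K"
    and step: "\<And>r L. \<lbrakk>r \<in> M; ideal L R; K \<subseteq> L; \<And>q m. \<lbrakk>q \<in> Q; m \<in> M\<rbrakk> \<Longrightarrow> q \<otimes> m \<in> L\<rbrakk>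
        \<Longrightarrow> \<exists>s\<in>carrier R - Q. s \<otimes> r \<in> L"
  shows "M \<subseteq> K"
proof (rule ccontr)
  assume nsub: "\<not> M \<subseteq> K"
  define F where "F = {J. ideal J R \<and> saturated Q J \<and> K \<subseteq> J \<and> \<not> M \<subseteq> J}"
  have "\<exists>J\<in>F. \<forall>L\<in>F. J \<subseteq> L \<longrightarrow> L = J"
  proof (rule maximal_ideal_in_family)
    show "F \<noteq> {}" using K nsub unfolding F_def by auto
  qed (simp add: F_def)
  then obtain J where JF: "J \<in> F" and max: "\<And>L. L \<in> F \<Longrightarrow> J \<subseteq> L \<Longrightarrow> L = J" by blast
  interpret M: ideal M R by fact
  interpret J: ideal J R using JF unfolding F_def by blast
  interpret Q: primeideal Q R by fact
  have J: "ideal J R" "saturated Q J" "K \<subseteq> J" "\<not> M \<subseteq> J" using JF unfolding F_def by auto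
  \<comment> \<open>Adjoining \<open>q m\<close> to \<open>J\<close> gives a larger saturated ideal, which contains \<open>M\<close> by maximality.\<close>
  have prod: "q \<otimes> m \<in> J" if q: "q \<in> Q" and m: "m \<in> M" for q m
  proof (rule ccontr)
    assume n: "q \<otimes> m \<notin> J"
    have c[simp]: "q \<in> carrier R" "m \<in> carrier R" using q m Q.Icarr M.Icarr by auto
    let ?A = "adjoin R J (q \<otimes> m)"
    have A: "ideal ?A R" using J by (intro adjoin_ideal) auto
    have sub: "J \<subseteq> saturation Q ?A" "q \<otimes> m \<in> saturation Q ?A"
      using adjoin_superset[OF J(1), of "q \<otimes> m"] adjoin_self[OF J(1), of "q \<otimes> m"]
        saturation_superset[OF Q A] by auto
    then have "saturation Q ?A \<notin> F" using max[of "saturation Q ?A"] n by metis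
    moreover have "K \<subseteq> saturation Q ?A" using sub(1) J(3) by simp
    ultimately have "M \<subseteq> saturation Q ?A"
      using saturation_ideal[OF Q A] saturation_saturated[OF Q] by (simp add: F_def)
    then obtain s where s: "s \<in> carrier R" "s \<notin> Q" "s \<otimes> m \<in> ?A"
      using m unfolding saturation_def by blast
    then obtain j t where jt: "j \<in> J" "t \<in> carrier R" "s \<otimes> m = j \<oplus> t \<otimes> (q \<otimes> m)"
      unfolding adjoin_def by blast
    have jc: "j \<in> carrier R" using jt J.Icarr by blast
    have "(s \<ominus> t \<otimes> q) \<otimes> m = s \<otimes> m \<ominus> t \<otimes> (q \<otimes> m)" using s jt(2) c by algebra
    also have "\<dots> = j" unfolding jt(3) using jt(2) jc c by algebra
    finally have "(s \<ominus> t \<otimes> q) \<otimes> m \<in> J" using jt(1) by simp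
    moreover have "s \<ominus> t \<otimes> q \<notin> Q"
    proof
      assume "s \<ominus> t \<otimes> q \<in> Q"
      then have "s \<ominus> t \<otimes> q \<oplus> t \<otimes> q \<in> Q" using q jt(2) by (intro Q.a_closed Q.I_l_closed)
      moreover have "s \<ominus> t \<otimes> q \<oplus> t \<otimes> q = s" using s jt(2) c by algebra
      ultimately show False using s by simp
    qed
    ultimately have "m \<in> J" using saturatedD[OF J(2), of "s \<ominus> t \<otimes> q" m] s jt by simp
    then show False using n by (simp add: J.I_l_closed)
  qed
  have "r \<in> J" if r: "r \<in> M" for r
  proof -
    obtain s where s: "s \<in> carrier R" "s \<notin> Q" "s \<otimes> r \<in> J"
      using step[OF r J(1) J(3) prod] by auto
    then show ?thesis using saturatedD[OF J(2) s(1,2) M.Icarr[OF r] s(3)] by simp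
  qed
  then show False using J(4) by blast
qed

end

section \<open>Krull's principal ideal theorem\<close>

context noetherian_cring
begin

text \<open>The local analogue of the existence of associated primes: an annihilator of an element modulo
\<open>L\<close> that is maximal among such annihilators is prime.\<close>

lemma saturated_annihilator_prime:
  assumes Q: "primeideal Q R" and L: "ideal L R" "saturated Q L" "L \<noteq> carrier R"
  shows "\<exists>g\<in>carrier R - L. primeideal {r \<in> carrier R. r \<otimes> g \<in> L} R
           \<and> L \<subseteq> {r \<in> carrier R. r \<otimes> g \<in> L} \<and> {r \<in> carrier R. r \<otimes> g \<in> L} \<subseteq> Q"
proof -
  interpret L: ideal L R by fact
  define ann where "ann g = {r \<in> carrier R. r \<otimes> g \<in> L}" for g
  have ideal_ann: "ideal (ann g) R" if "g \<in> carrier R" for g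
    unfolding ann_def using colon_ideal[OF L(1) that] .
  have "\<exists>M\<in>ann ` (carrier R - L). \<forall>J\<in>ann ` (carrier R - L). M \<subseteq> J \<longrightarrow> J = M"
  proof (rule maximal_ideal_in_family)
    show "ann ` (carrier R - L) \<noteq> {}" using L.a_subset L(3) by blast
  qed (auto intro: ideal_ann)
  then obtain g where g: "g \<in> carrier R" "g \<notin> L"
    and max: "\<And>h. h \<in> carrier R \<Longrightarrow> h \<notin> L \<Longrightarrow> ann g \<subseteq> ann h \<Longrightarrow> ann h = ann g" by blast
  have "primeideal (ann g) R"
  proof (rule primeidealI[OF ideal_ann[OF g(1)] is_cring])
    have "\<one> \<notin> ann g" using g unfolding ann_def by simp
    then show "carrier R \<noteq> ann g" by auto
    fix u v assume u: "u \<in> carrier R" and v: "v \<in> carrier R" and uv: "u \<otimes> v \<in> ann g"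
    show "u \<in> ann g \<or> v \<in> ann g"
    proof (rule disjCI)
      assume vn: "v \<notin> ann g"
      have "ann g \<subseteq> ann (v \<otimes> g)"
      proof
        fix r assume r: "r \<in> ann g"
        then have "r \<otimes> (v \<otimes> g) = v \<otimes> (r \<otimes> g)" using v g(1) m_lcomm unfolding ann_def by auto
        then show "r \<in> ann (v \<otimes> g)" using r v L.I_l_closed unfolding ann_def by auto
      qed
      then have "ann (v \<otimes> g) = ann g"
        using vn v g(1) by (intro max) (auto simp: ann_def)
      moreover have "u \<in> ann (v \<otimes> g)" using uv u v g(1) by (simp add: ann_def m_assoc)
      ultimately show "u \<in> ann g" by simp
    qed
  qed
  moreover have "L \<subseteq> ann g" using g L.I_r_closed unfolding ann_def by auto
  moreover have "ann g \<subseteq> Q"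
  proof
    fix s assume s: "s \<in> ann g"
    show "s \<in> Q"
    proof (rule ccontr)
      assume "s \<notin> Q"
      then have "g \<in> L" using s g(1) saturatedD[OF L(2)] unfolding ann_def by blast
      then show False using g(2) by simp
    qed
  qed
  ultimately show ?thesis using g unfolding ann_def by blast
qed

text \<open>Locally at \<open>Q\<close>, the ring modulo the intersection of the chain has \<open>Q\<close> as its only prime, hence is
artinian. Call \<open>L\<close> stable if the traces of the chain on \<open>L\<close> are eventually constant, and take a
maximal stable \<open>L\<close>. If \<open>L\<close> were proper, adding to it an element \<open>g\<close> with annihilator \<open>Q\<close> modulo \<open>L\<close>
adds one composition factor, and this preserves stability.\<close>

lemma descending_chain_stabilizes:
  fixes J :: "nat \<Rightarrow> 'a set"
  assumes Q: "primeideal Q R"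
    and J: "\<And>n. ideal (J n) R" "\<And>n. saturated Q (J n)" "\<And>n. J (Suc n) \<subseteq> J n"
    and minimal: "\<And>P. primeideal P R \<Longrightarrow> (\<Inter>n. J n) \<subseteq> P \<Longrightarrow> P \<subseteq> Q \<Longrightarrow> P = Q"
  shows "\<exists>n. J (Suc n) = J n"
proof -
  interpret Q: primeideal Q R by fact
  have anti: "J n \<subseteq> J m" if "m \<le> n" for m n
    using that J(3) by (metis lift_Suc_antimono_le)
  define stab where "stab L \<longleftrightarrow> (\<exists>k. \<forall>n\<ge>k. J n \<inter> L = J k \<inter> L)" for L
  define F where "F = {L. ideal L R \<and> saturated Q L \<and> (\<Inter>n. J n) \<subseteq> L \<and> stab L}"
  have "(\<Inter>n. J n) \<in> F"
  proof -
    have "ideal (\<Inter>n. J n) R" using J(1) by (intro i_Intersect) auto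
    moreover have "saturated Q (\<Inter>n. J n)" using J(2) unfolding saturated_def by blast
    moreover have "stab (\<Inter>n. J n)" unfolding stab_def by blast
    ultimately show ?thesis unfolding F_def by blast
  qed
  then have "F \<noteq> {}" by blast
  then have "\<exists>L\<in>F. \<forall>L'\<in>F. L \<subseteq> L' \<longrightarrow> L' = L"
    by (intro maximal_ideal_in_family) (auto simp: F_def)
  then obtain L where LF: "L \<in> F" and max: "\<And>L'. L' \<in> F \<Longrightarrow> L \<subseteq> L' \<Longrightarrow> L' = L" by blast
  have L: "ideal L R" "saturated Q L" "(\<Inter>n. J n) \<subseteq> L" "stab L" using LF unfolding F_def by auto
  interpret L: ideal L R by fact
  have "L = carrier R"
  proof (rule ccontr)
    assume "L \<noteq> carrier R"
    then obtain g where g: "g \<in> carrier R" "g \<notin> L" and prime: "primeideal {r \<in> carrier R. r \<otimes> g \<in> L} R"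
      and sub: "L \<subseteq> {r \<in> carrier R. r \<otimes> g \<in> L}" "{r \<in> carrier R. r \<otimes> g \<in> L} \<subseteq> Q"
      using saturated_annihilator_prime[OF Q L(1,2)] by blast
    have "{r \<in> carrier R. r \<otimes> g \<in> L} = Q" using minimal[OF prime _ sub(2)] sub(1) L(3) by blast
    then have ann: "r \<otimes> g \<in> L" if "r \<in> Q" for r using that by blast
    define L' where "L' = saturation Q (adjoin R L g)"
    have A: "ideal (adjoin R L g) R" using adjoin_ideal[OF L(1) g(1)] .
    have sub': "L \<subseteq> L'" "g \<in> L'"
      using adjoin_superset[OF L(1) g(1)] adjoin_self[OF L(1) g(1)] saturation_superset[OF Q A]
      unfolding L'_def by auto
    have repr: "\<exists>s l r. s \<in> carrier R - Q \<and> l \<in> L \<and> r \<in> carrier R \<and> s \<otimes> k = l \<oplus> r \<otimes> g"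
      if "k \<in> L'" for k
      using that unfolding L'_def saturation_def adjoin_def by blast
    have "stab L'"
    proof (cases "\<exists>k. J k \<inter> L' \<subseteq> L")
      case True
      then obtain k where k: "J k \<inter> L' \<subseteq> L" by blast
      obtain k' where k': "\<And>n. n \<ge> k' \<Longrightarrow> J n \<inter> L = J k' \<inter> L" using L(4) unfolding stab_def by blast
      have "J n \<inter> L' = J n \<inter> L" if "n \<ge> max k k'" for n
        using k anti[of k n] that sub'(1) by auto
      then have "J n \<inter> L' = J (max k k') \<inter> L'" if "n \<ge> max k k'" for n
        using k'[of n] k'[of "max k k'"] that by auto
      then show ?thesis unfolding stab_def by blast
    next
      case False
      obtain k where k: "\<And>n. n \<ge> k \<Longrightarrow> J n \<inter> L = J k \<inter> L" using L(4) unfolding stab_def by blast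
      have "u \<in> J n" if n: "n \<ge> k" and u: "u \<in> J k" "u \<in> L'" for n u
      proof -
        \<comment> \<open>Up to factors outside \<open>Q\<close>, both \<open>u\<close> and \<open>w\<close> are multiples of \<open>g\<close> modulo \<open>L\<close>; eliminating \<open>g\<close> leaves an element of \<open>L\<close>.\<close>
        obtain w where w: "w \<in> J n" "w \<in> L'" "w \<notin> L" using False by blast
        obtain s l r where s: "s \<in> carrier R" "s \<notin> Q" "l \<in> L" "r \<in> carrier R" "s \<otimes> u = l \<oplus> r \<otimes> g"
          using repr[OF u(2)] by blast
        obtain s' l' r' where s': "s' \<in> carrier R" "s' \<notin> Q" "l' \<in> L" "r' \<in> carrier R" "s' \<otimes> w = l' \<oplus> r' \<otimes> g"
          using repr[OF w(2)] by blast
        have c: "u \<in> carrier R" "w \<in> carrier R" "l \<in> carrier R" "l' \<in> carrier R"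
          using ideal.Icarr[OF J(1)] u w s s' L.Icarr by auto
        have "r' \<notin> Q"
        proof
          assume "r' \<in> Q"
          then have "s' \<otimes> w \<in> L" using s' ann by (simp add: L.a_closed)
          then show False using saturatedD[OF L(2) s'(1,2) c(2)] w(3) by simp
        qed
        then have rs: "r' \<otimes> s \<in> carrier R - Q" using prime_not_mult[OF Q] s s' by auto
        have eq: "r' \<otimes> (s \<otimes> u) \<ominus> r \<otimes> (s' \<otimes> w) = r' \<otimes> l \<ominus> r \<otimes> l'"
          unfolding s(5) s'(5) using s(4) s'(4) g(1) c by algebra
        have wk: "w \<in> J k" using w(1) anti[OF n] by blast
        have "r' \<otimes> l \<ominus> r \<otimes> l' \<in> L"
          using s s' L.I_l_closed by (intro ideal_minus_closed L(1)) auto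
        moreover have "r' \<otimes> (s \<otimes> u) \<ominus> r \<otimes> (s' \<otimes> w) \<in> J k"
          by (intro ideal_minus_closed J(1) ideal.I_l_closed[OF J(1)] u(1) wk s(1,4) s'(1,4))
        ultimately have "r' \<otimes> (s \<otimes> u) \<ominus> r \<otimes> (s' \<otimes> w) \<in> J n" using k[OF n] eq by auto
        moreover have "r \<otimes> (s' \<otimes> w) \<in> J n"
          by (intro ideal.I_l_closed[OF J(1)] w(1) s(4) s'(1))
        ultimately have "(r' \<otimes> (s \<otimes> u) \<ominus> r \<otimes> (s' \<otimes> w)) \<oplus> r \<otimes> (s' \<otimes> w) \<in> J n"
          by (rule ideal_add_closed[OF J(1)])
        moreover have "(r' \<otimes> (s \<otimes> u) \<ominus> r \<otimes> (s' \<otimes> w)) \<oplus> r \<otimes> (s' \<otimes> w) = r' \<otimes> s \<otimes> u"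
          using s(1,4) s'(1,4) c by algebra
        ultimately show ?thesis using saturatedD[OF J(2), of "r' \<otimes> s" u n] rs c by simp
      qed
      then have "J n \<inter> L' = J k \<inter> L'" if "n \<ge> k" for n using that anti[OF that] by blast
      then show ?thesis unfolding stab_def by blast
    qed
    then have "L' \<in> F"
      using saturation_ideal[OF Q A] saturation_saturated[OF Q] sub'(1) L(3) unfolding F_def L'_def by auto
    then show False using max[OF _ sub'(1)] sub'(2) g(2) by blast
  qed
  with L(4) have "stab (carrier R)" by simp
  then obtain k where k: "\<forall>n\<ge>k. J n \<inter> carrier R = J k \<inter> carrier R"
    unfolding stab_def by (elim exE)
  have "J (Suc k) \<inter> carrier R = J k \<inter> carrier R" by (rule k[rule_format]) simp
  moreover have "J n \<inter> carrier R = J n" for n using ideal.Icarr[OF J(1)[of n]] by auto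
  ultimately have "J (Suc k) = J k" by simp
  then show ?thesis by (rule exI)
qed

lemma prime_pow_mem:
  assumes "primeideal P R" "p \<in> carrier R" "p [^] (n::nat) \<in> P" shows "p \<in> P"
  using assms(3)
proof (induction n)
  case 0
  then show ?case using prime_one_not[OF assms(1)] by simp
next
  case (Suc n)
  then show ?case using primeideal.I_prime[OF assms(1), of "p [^] n" p] assms(2) by auto
qed

text \<open>Krull's principal ideal theorem, in the form: \<open>Q\<close> is not minimal over \<open>N + (x)\<close>. Suppose it is, so
that \<open>x \<notin> P\<close>. For \<open>p \<in> P - N\<close> let \<open>K n\<close> be the \<open>P\<close>-saturation of \<open>N + (p^n)\<close>. The \<open>Q\<close>-saturations of
\<open>K n + (x)\<close> stabilize; since \<open>x\<close> is regular modulo \<open>K n\<close>, Nakayama gives \<open>K n = K (n + 1)\<close>. So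
\<open>s p^n - t p^(n+1) \<in> N\<close> with \<open>s \<notin> P\<close>, which is impossible for a prime \<open>N\<close> below \<open>P\<close>.\<close>

theorem insert_prime_containing:
  assumes N: "primeideal N R" and P: "primeideal P R" and Q: "primeideal Q R"
    and NP: "N \<subset> P" and PQ: "P \<subset> Q" and x: "x \<in> Q"
  shows "\<exists>P'. primeideal P' R \<and> N \<subset> P' \<and> P' \<subset> Q \<and> x \<in> P'"
proof (rule ccontr)
  assume none: "\<not> ?thesis"
  interpret N: primeideal N R by fact
  interpret P: primeideal P R by fact
  interpret Q: primeideal Q R by fact
  have xP: "x \<notin> P" and xN: "x \<notin> N" and xc: "x \<in> carrier R"
    using none P NP PQ x Q.Icarr by auto
  obtain p where p: "p \<in> P" "p \<notin> N" using NP by blast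
  have pc: "p \<in> carrier R" using p P.Icarr by blast
  define K where "K n = saturation P (adjoin R N (p [^] n))" for n :: nat
  define J where "J n = saturation Q (adjoin R (K n) x)" for n
  have A: "ideal (adjoin R N (p [^] n)) R" for n :: nat
    using pc by (intro adjoin_ideal N.is_ideal) simp
  have K: "ideal (K n) R" "saturated P (K n)" for n
    unfolding K_def using saturation_ideal[OF P A] saturation_saturated[OF P] by auto
  have B: "ideal (adjoin R (K n) x) R" for n by (rule adjoin_ideal[OF K(1) xc])
  have J: "ideal (J n) R" "saturated Q (J n)" for n
    unfolding J_def using saturation_ideal[OF Q B] saturation_saturated[OF Q] by auto
  have NK: "N \<subseteq> K n" and pK: "p [^] n \<in> K n" for n
    using saturation_superset[OF P A] adjoin_superset[OF N.is_ideal, of "p [^] n"]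
      adjoin_self[OF N.is_ideal, of "p [^] n"] pc unfolding K_def by auto
  have KJ: "K n \<subseteq> J n" and xJ: "x \<in> J n" for n
    using saturation_superset[OF Q B[of n]] adjoin_superset[OF K(1)[of n] xc] adjoin_self[OF K(1)[of n] xc]
    unfolding J_def by auto
  have KK: "K (Suc n) \<subseteq> K n" for n
  proof -
    have "p [^] Suc n \<in> adjoin R N (p [^] n)"
      using ideal.I_r_closed[OF A adjoin_self[OF N.is_ideal]] pc by simp
    then have "adjoin R N (p [^] Suc n) \<subseteq> adjoin R N (p [^] n)"
      using adjoin_superset[OF N.is_ideal, of "p [^] n"] pc by (intro adjoin_minimal A) auto
    then show ?thesis unfolding K_def saturation_def by blast
  qed
  have JJ: "J (Suc n) \<subseteq> J n" for n
    using KK[of n] unfolding J_def saturation_def adjoin_def by blast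
  have "\<exists>n. J (Suc n) = J n"
  proof (rule descending_chain_stabilizes[where J = J, OF Q J JJ])
    fix P' assume P': "primeideal P' R" "(\<Inter>n. J n) \<subseteq> P'" "P' \<subseteq> Q"
    have "N \<subseteq> (\<Inter>n. J n)" using NK KJ by (intro INT_greatest) (rule order_trans)
    moreover have "x \<in> (\<Inter>n. J n)" using xJ by simp
    ultimately have "N \<subset> P'" "x \<in> P'" using P'(2) xN by auto
    then show "P' = Q" using none P'(1,3) by auto
  qed
  then obtain n where n: "J (Suc n) = J n" by blast
  have "K n \<subseteq> K (Suc n)"
  proof (rule nakayama_saturated[OF Q K(1) K(1)])
    show "saturated Q (K (Suc n))" using saturated_mono[OF K(2)] PQ by blast
    fix r L assume r: "r \<in> K n" and L: "ideal L R" "K (Suc n) \<subseteq> L"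
      and QL: "\<And>q m. q \<in> Q \<Longrightarrow> m \<in> K n \<Longrightarrow> q \<otimes> m \<in> L"
    have "r \<in> saturation Q (adjoin R (K (Suc n)) x)" using r KJ[of n] n unfolding J_def by blast
    then obtain s k t where s: "s \<in> carrier R" "s \<notin> Q" "k \<in> K (Suc n)" "t \<in> carrier R"
      "s \<otimes> r = k \<oplus> t \<otimes> x"
      by (rule saturation_adjoinE)
    have c: "k \<in> carrier R" "r \<in> carrier R" using s(3) r ideal.Icarr[OF K(1)] by auto
    have "s \<otimes> r \<ominus> k \<in> K n"
      using s(1,3) KK r ideal.I_l_closed[OF K(1)] by (intro ideal_minus_closed K(1)) auto
    moreover have "s \<otimes> r \<ominus> k = x \<otimes> t" unfolding s(5) using s(4) xc c by algebra
    ultimately have "t \<in> K n" using saturatedD[OF K(2) xc xP s(4)] by simp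
    then have "x \<otimes> t \<in> L" using QL x by blast
    then have "k \<oplus> t \<otimes> x \<in> L" using s(3,4) L xc m_comm by (intro ideal_add_closed L(1)) auto
    then have "s \<otimes> r \<in> L" using s(5) by simp
    then show "\<exists>s\<in>carrier R - Q. s \<otimes> r \<in> L" using s(1,2) by blast
  qed
  then have "p [^] n \<in> saturation P (adjoin R N (p [^] Suc n))" using pK[of n] unfolding K_def by blast
  then obtain s \<nu> t where s: "s \<in> carrier R" "s \<notin> P" "\<nu> \<in> N" "t \<in> carrier R"
    "s \<otimes> p [^] n = \<nu> \<oplus> t \<otimes> p [^] Suc n"
    by (rule saturation_adjoinE)
  have \<nu>c: "\<nu> \<in> carrier R" and pn: "p [^] n \<in> carrier R" using s(3) N.Icarr pc by auto
  have "(s \<ominus> t \<otimes> p) \<otimes> p [^] n = s \<otimes> p [^] n \<ominus> t \<otimes> (p [^] n \<otimes> p)"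
    using s(1,4) pn pc by algebra
  also have "\<dots> = \<nu>" unfolding s(5) nat_pow_Suc using s(4) pn pc \<nu>c by algebra
  finally have "(s \<ominus> t \<otimes> p) \<otimes> p [^] n \<in> N" using s(3) by simp
  then consider "s \<ominus> t \<otimes> p \<in> N" | "p [^] n \<in> N"
    using N.I_prime[of "s \<ominus> t \<otimes> p" "p [^] n"] s pc pn by auto
  then show False
  proof cases
    case 1
    then have "(s \<ominus> t \<otimes> p) \<oplus> t \<otimes> p \<in> P"
      using NP p(1) s(4) P.I_l_closed by (intro P.a_closed) auto
    moreover have "(s \<ominus> t \<otimes> p) \<oplus> t \<otimes> p = s" using s(1,4) pc by algebra
    ultimately show False using s(2) by simp
  next
    case 2
    then show False using prime_pow_mem[OF N pc] p(2) by blast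
  qed
qed

end

section \<open>Chains of primes and systems of parameters\<close>

context noetherian_cring
begin

text \<open>Working downwards from the top, which contains \<open>x\<close>, each member except the bottom one is replaced
by a prime that contains \<open>x\<close>.\<close>

lemma prime_chain_through_element:
  assumes "prime_chain R (Suc n) p" "x \<in> p (Suc n)"
  shows "\<exists>q. prime_chain R (Suc n) q \<and> q 0 = p 0 \<and> q (Suc n) = p (Suc n) \<and> x \<in> q (Suc 0)"
  using assms
proof (induction n arbitrary: p)
  case 0
  then show ?case by blast
next
  case (Suc n)
  have pr: "primeideal (p i) R" if "i \<le> Suc (Suc n)" for i
    using Suc.prems(1) that unfolding prime_chain_def by blast
  have lt: "p i \<subset> p (Suc i)" if "i < Suc (Suc n)" for i
    using Suc.prems(1) that unfolding prime_chain_def by blast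
  obtain P' where P': "primeideal P' R" "p n \<subset> P'" "P' \<subset> p (Suc (Suc n))" "x \<in> P'"
    using insert_prime_containing[OF pr pr pr lt lt Suc.prems(2)] by auto
  let ?p = "p(Suc n := P')"
  have chain: "prime_chain R (Suc n) ?p"
    unfolding prime_chain_def using pr lt P'(1,2) by (auto simp: less_Suc_eq)
  then obtain q where q: "prime_chain R (Suc n) q" "q 0 = p 0" "q (Suc n) = P'" "x \<in> q (Suc 0)"
    using Suc.IH[OF chain] P'(4) by auto
  let ?q = "q(Suc (Suc n) := p (Suc (Suc n)))"
  have "prime_chain R (Suc (Suc n)) ?q"
    unfolding prime_chain_def
  proof (intro conjI allI impI)
    fix i assume "i \<le> Suc (Suc n)"
    then show "primeideal (?q i) R" using q(1) pr unfolding prime_chain_def by (auto simp: le_Suc_eq)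
  next
    fix i assume "i < Suc (Suc n)"
    then show "?q i \<subset> ?q (Suc i)"
      using q(1,3) P'(3) unfolding prime_chain_def by (auto simp: less_Suc_eq)
  qed
  moreover have "?q 0 = p 0" "?q (Suc (Suc n)) = p (Suc (Suc n))" "x \<in> ?q (Suc 0)"
    using q(2,4) by simp_all
  ultimately show ?case by blast
qed

end

fun adjoin_list :: "('a, 'b) ring_scheme \<Rightarrow> 'a set \<Rightarrow> 'a list \<Rightarrow> 'a set" where
  "adjoin_list R J [] = J"
| "adjoin_list R J (a # as) = adjoin_list R (adjoin R J a) as"

lemma (in cring) adjoin_list_superset:
  "ideal J R \<Longrightarrow> set as \<subseteq> carrier R \<Longrightarrow> J \<subseteq> adjoin_list R J as"
proof (induction as arbitrary: J)
  case (Cons a as)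
  then show ?case using adjoin_superset[of J a] adjoin_ideal[of J a] Cons.IH[of "adjoin R J a"] by auto
qed simp

context noetherian_local_ring
begin

lemma max_ideal: "ideal \<mm> R" and max_prime: "primeideal \<mm> R" and max_subset_carrier: "\<mm> \<subseteq> carrier R"
proof -
  show max: "ideal \<mm> R" using maximal by (simp add: maximalideal_def)
  show "\<mm> \<subseteq> carrier R" using ideal.Icarr[OF max] by (rule subsetI)
  show "primeideal \<mm> R" using maximalideal_prime[OF maximal] .
qed

lemma proper_ideal_subset_max:
  assumes J: "ideal J R" "J \<noteq> carrier R" shows "J \<subseteq> \<mm>"
proof -
  define F where "F = {L. ideal L R \<and> J \<subseteq> L \<and> L \<noteq> carrier R}"
  have "\<exists>M\<in>F. \<forall>L\<in>F. M \<subseteq> L \<longrightarrow> L = M"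
    using J by (intro maximal_ideal_in_family) (auto simp: F_def)
  then obtain M where MF: "M \<in> F" and max: "\<And>L. L \<in> F \<Longrightarrow> M \<subseteq> L \<Longrightarrow> L = M" by blast
  then have M: "ideal M R" "J \<subseteq> M" "M \<noteq> carrier R" unfolding F_def by auto
  have "maximalideal M R"
  proof (rule maximalidealI[OF M(1)])
    show "carrier R \<noteq> M" using M(3) by simp
    fix L assume L: "ideal L R" "M \<subseteq> L" "L \<subseteq> carrier R"
    then show "L = M \<or> L = carrier R" using max[of L] M(2) unfolding F_def by auto
  qed
  then show ?thesis using maximal_unique M(2) by blast
qed

lemma unit_outside_max:
  assumes u: "u \<in> carrier R" "u \<notin> \<mm>" shows "\<exists>v\<in>carrier R. v \<otimes> u = \<one>"
proof -
  have "PIdl u = carrier R"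
    using proper_ideal_subset_max[OF cgenideal_ideal[OF u(1)]] cgenideal_self[OF u(1)] u(2) by blast
  then have "\<one> \<in> PIdl u" by simp
  then obtain v where "v \<in> carrier R" "\<one> = v \<otimes> u" unfolding cgenideal_def by blast
  then show ?thesis by (intro bexI[of _ v]) simp_all
qed

lemma saturated_max: assumes "ideal J R" shows "saturated \<mm> J"
  unfolding saturated_def
proof (intro ballI impI)
  fix s r assume s: "s \<in> carrier R - \<mm>" and r: "r \<in> carrier R" and sr: "s \<otimes> r \<in> J"
  obtain v where v: "v \<in> carrier R" "v \<otimes> s = \<one>" using unit_outside_max[of s] s by blast
  have "v \<otimes> (s \<otimes> r) = r" using s r v by (simp add: m_assoc[symmetric])
  then show "r \<in> J" using ideal.I_l_closed[OF assms sr v(1)] by simp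
qed

text \<open>In a local ring every ideal is saturated with respect to the maximal ideal.\<close>

lemma nakayama:
  assumes M: "ideal M R" and K: "ideal K R"
    and step: "\<And>r. r \<in> M \<Longrightarrow> \<exists>k\<in>K. \<exists>q\<in>\<mm>. \<exists>m\<in>M. r = k \<oplus> q \<otimes> m"
  shows "M \<subseteq> K"
proof (rule nakayama_saturated[OF max_prime M K saturated_max[OF K]])
  fix r L assume r: "r \<in> M" and L: "ideal L R" "K \<subseteq> L"
    and mL: "\<And>q m. \<lbrakk>q \<in> \<mm>; m \<in> M\<rbrakk> \<Longrightarrow> q \<otimes> m \<in> L"
  obtain k q m where "k \<in> K" "q \<in> \<mm>" "m \<in> M" "r = k \<oplus> q \<otimes> m" using step[OF r] by blast
  then have "r \<in> L" using L mL by (auto intro: ideal_add_closed)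
  then show "\<exists>s\<in>carrier R - \<mm>. s \<otimes> r \<in> L"
    using prime_one_not[OF max_prime] ideal.Icarr[OF M r] by (intro bexI[of _ \<one>]) auto
qed

lemma prime_subset_max: "primeideal P R \<Longrightarrow> P \<subseteq> \<mm>"
  by (intro proper_ideal_subset_max) (auto simp: primeideal_def primeideal_axioms_def)

text \<open>Dropping the bottom of a rerouted chain leaves a chain of primes that contain \<open>x\<close>. This is the
induction step for both theorems on parameters below.\<close>

lemma prime_chain_through_shift:
  assumes p: "prime_chain R (Suc n) p" and x: "x \<in> \<mm>"
  obtains q where "prime_chain R n q" "p 0 \<subset> q 0" "x \<in> q 0"
proof -
  let ?p = "p(Suc n := \<mm>)"
  have "p n \<subset> p (Suc n)" "p (Suc n) \<subseteq> \<mm>"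
    using p prime_subset_max unfolding prime_chain_def by auto
  then have "p n \<subset> \<mm>" by blast
  then have "prime_chain R (Suc n) ?p"
    using p max_prime unfolding prime_chain_def by (auto simp: less_Suc_eq)
  then obtain q where q: "prime_chain R (Suc n) q" "q 0 = p 0" "x \<in> q (Suc 0)"
    using prime_chain_through_element[of n ?p x] x by auto
  have "prime_chain R n (\<lambda>i. q (Suc i))" using q(1) unfolding prime_chain_def by auto
  moreover have "p 0 \<subset> q (Suc 0)" using q(1,2) unfolding prime_chain_def by auto
  ultimately show thesis using that[of "\<lambda>i. q (Suc i)"] q(3) by simp
qed

text \<open>A local ring whose maximal ideal has \<open>n\<close> generators modulo \<open>J\<close> has dimension at most \<open>n\<close> modulo
\<open>J\<close>.\<close>

theorem prime_chain_length_le: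
  assumes "ideal J R" "set as \<subseteq> carrier R" "adjoin_list R J as = \<mm>" "prime_chain R n p" "J \<subseteq> p 0"
  shows "n \<le> length as"
  using assms
proof (induction as arbitrary: J n p)
  case Nil
  show ?case
  proof (cases n)
    case (Suc k)
    then have "p 0 \<subset> p (Suc 0)" "p (Suc 0) \<subseteq> \<mm>"
      using Nil prime_subset_max unfolding prime_chain_def by auto
    then show ?thesis using Nil by auto
  qed simp
next
  case (Cons a as)
  show ?case
  proof (cases n)
    case (Suc k)
    have a: "a \<in> carrier R" using Cons.prems by simp
    have A: "ideal (adjoin R J a) R" by (rule adjoin_ideal[OF Cons.prems(1) a])
    have "a \<in> \<mm>"
      using adjoin_self[OF Cons.prems(1) a] adjoin_list_superset[OF A, of as] Cons.prems by auto
    then obtain q where q: "prime_chain R k q" "p 0 \<subset> q 0" "a \<in> q 0"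
      using prime_chain_through_shift[of k p a] Cons.prems(4) Suc by blast
    have "ideal (q 0) R" using q(1) unfolding prime_chain_def primeideal_def by auto
    then have "adjoin R J a \<subseteq> q 0" using q Cons.prems(5) by (intro adjoin_minimal) auto
    then have "k \<le> length as" using Cons.IH[OF A _ _ q(1)] Cons.prems by simp
    then show ?thesis using Suc by simp
  qed simp
qed

lemma prime_chain_prepend:
  assumes "prime_chain R n q" "primeideal P R" "P \<subset> q 0"
  shows "prime_chain R (Suc n) (case_nat P q)"
  using assms unfolding prime_chain_def by (auto split: nat.splits simp: less_Suc_eq_0_disj)

text \<open>Regular local rings are domains. By induction \<open>J + (a)\<close> is prime, since the rerouted chain
\<open>q\<close> lies above it. If \<open>p 0\<close> were not contained in \<open>J + (a)\<close>, then \<open>J + (a)\<close> would differ from \<open>q 0\<close> and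
could be put below \<open>q\<close>, which makes the chain too long. So each \<open>r \<in> p 0\<close> is \<open>j + t a\<close>, where
\<open>t \<in> p 0\<close> because \<open>a \<notin> p 0\<close>, and Nakayama gives \<open>p 0 = J\<close>.\<close>

theorem parameters_prime:
  assumes "ideal J R" "set as \<subseteq> carrier R" "adjoin_list R J as = \<mm>" "prime_chain R (length as) p" "J \<subseteq> p 0"
  shows "primeideal J R"
  using assms
proof (induction as arbitrary: J p)
  case Nil
  then show ?case using max_prime by simp
next
  case (Cons a as)
  have a: "a \<in> carrier R" using Cons.prems by simp
  have as: "set as \<subseteq> carrier R" using Cons.prems by simp
  have J: "ideal J R" by fact
  have A: "ideal (adjoin R J a) R" by (rule adjoin_ideal[OF J a])
  have mA: "adjoin_list R (adjoin R J a) as = \<mm>" using Cons.prems by simp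
  have am: "a \<in> \<mm>"
    using adjoin_self[OF J a] adjoin_list_superset[OF A as] mA by auto
  obtain q where q: "prime_chain R (length as) q" "p 0 \<subset> q 0" "a \<in> q 0"
    using prime_chain_through_shift[of "length as" p a] Cons.prems(4) am by auto
  have p0: "primeideal (p 0) R" using Cons.prems(4) unfolding prime_chain_def by auto
  interpret p0: primeideal "p 0" R by fact
  interpret J: ideal J R by fact
  have q0: "ideal (q 0) R" using q(1) unfolding prime_chain_def primeideal_def by auto
  have P: "primeideal (adjoin R J a) R"
    using Cons.IH[OF A as mA q(1)] adjoin_minimal[OF q0, of J a] q Cons.prems(5) by auto
  have a_p0: "a \<notin> p 0"
  proof
    assume "a \<in> p 0"
    then have "adjoin R J a \<subseteq> p 0" using Cons.prems(5) by (intro adjoin_minimal p0.is_ideal)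
    then show False using prime_chain_length_le[OF A as mA Cons.prems(4)] by simp
  qed
  have "p 0 \<subseteq> adjoin R J a"
  proof (rule ccontr)
    assume "\<not> p 0 \<subseteq> adjoin R J a"
    then have "adjoin R J a \<subset> q 0"
      using adjoin_minimal[OF q0, of J a] q Cons.prems(5) by auto
    then have "prime_chain R (Suc (length as)) (case_nat (adjoin R J a) q)"
      by (intro prime_chain_prepend q(1) P)
    then show False using prime_chain_length_le[OF A as mA] by fastforce
  qed
  have "p 0 \<subseteq> J"
  proof (rule nakayama[OF p0.is_ideal J])
    fix r assume r: "r \<in> p 0"
    then have "r \<in> adjoin R J a" using \<open>p 0 \<subseteq> adjoin R J a\<close> by blast
    then obtain j t where jt: "j \<in> J" "t \<in> carrier R" "r = j \<oplus> t \<otimes> a" by (rule adjoinE)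
    have c: "r \<in> carrier R" "j \<in> carrier R" using r jt J.Icarr p0.Icarr by auto
    have "r \<ominus> j \<in> p 0" using r jt(1) Cons.prems(5) by (intro ideal_minus_closed p0.is_ideal) auto
    moreover have "r \<ominus> j = t \<otimes> a" unfolding jt(3) using jt(2) a c by algebra
    ultimately have "t \<in> p 0" using p0.I_prime[OF jt(2) a] a_p0 by auto
    moreover have "r = j \<oplus> a \<otimes> t" using jt a m_comm by simp
    ultimately show "\<exists>k\<in>J. \<exists>q\<in>\<mm>. \<exists>m\<in>p 0. r = k \<oplus> q \<otimes> m" using jt(1) am by blast
  qed
  then have "J = p 0" using Cons.prems(5) by auto
  then show ?case using p0 by simp
qed

lemma parameters_first_step:
  assumes "ideal J R" "set (a # as) \<subseteq> carrier R" "adjoin_list R J (a # as) = \<mm>"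
    "prime_chain R (length (a # as)) p" "J \<subseteq> p 0"
  shows "a \<notin> J" "\<exists>q. prime_chain R (length as) q \<and> adjoin R J a \<subseteq> q 0"
proof -
  have a: "a \<in> carrier R" and as: "set as \<subseteq> carrier R" using assms(2) by auto
  have A: "ideal (adjoin R J a) R" by (rule adjoin_ideal[OF assms(1) a])
  show "a \<notin> J"
  proof
    assume "a \<in> J"
    then have "adjoin R J a \<subseteq> J" by (intro adjoin_minimal assms(1)) auto
    then show False using prime_chain_length_le[OF A as _ assms(4)] assms(3,5) by auto
  qed
  have "a \<in> \<mm>" using adjoin_self[OF assms(1) a] adjoin_list_superset[OF A as] assms(3) by auto
  then obtain q where q: "prime_chain R (length as) q" "p 0 \<subset> q 0" "a \<in> q 0"
    using prime_chain_through_shift[of "length as" p a] assms(4) by auto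
  have "ideal (q 0) R" using q(1) unfolding prime_chain_def primeideal_def by auto
  then have "adjoin R J a \<subseteq> q 0" using q assms(5) by (intro adjoin_minimal) auto
  then show "\<exists>q. prime_chain R (length as) q \<and> adjoin R J a \<subseteq> q 0" using q(1) by blast
qed

end

text \<open>The dimension is a supremum of natural numbers, so a finite positive value is attained.\<close>

lemma krull_dim_attained:
  assumes "krull_dim R = enat (Suc n)"
  shows "\<exists>p. prime_chain R (Suc n) p"
proof (rule ccontr)
  let ?S = "{enat k | k. \<exists>p. prime_chain R k p}"
  assume none: "\<not> ?thesis"
  have "k \<le> n" if "prime_chain R k p" for k p
  proof -
    have "enat k \<le> Sup ?S" using that by (intro Sup_upper) blast
    then have "k \<le> Suc n" using assms unfolding krull_dim_def by simp
    then show ?thesis using none that by (cases "k = Suc n") auto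
  qed
  then have "Sup ?S \<le> enat n" by (intro Sup_least) auto
  then show False using assms unfolding krull_dim_def by simp
qed

lemma prime_chain_le_krull_dim:
  assumes "prime_chain R n p" shows "enat n \<le> krull_dim R"
  unfolding krull_dim_def using assms by (intro Sup_upper) blast

context noetherian_local_ring
begin

text \<open>A chain that ends at \<open>P\<close> can be extended by the maximal ideal.\<close>

lemma ideal_height_less_krull_dim:
  assumes "primeideal P R" "P \<noteq> \<mm>" "krull_dim R = enat (Suc d)"
  shows "ideal_height R P \<le> enat d"
  unfolding ideal_height_def
proof (rule Sup_least)
  fix h assume "h \<in> {enat n | n. \<exists>p. prime_chain R n p \<and> p n = P}"
  then obtain n p where n: "h = enat n" "prime_chain R n p" "p n = P" by blast
  have "P \<subset> \<mm>" using assms(1,2) prime_subset_max by blast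
  then have "prime_chain R (Suc n) (p(Suc n := \<mm>))"
    using n(2,3) max_prime unfolding prime_chain_def by (auto simp: less_Suc_eq)
  then have "enat (Suc n) \<le> enat (Suc d)" using prime_chain_le_krull_dim assms(3) by metis
  then show "h \<le> enat d" using n(1) by simp
qed

end

section \<open>Regular sequences of length three\<close>

text \<open>The facts about a regular local ring of dimension three on which the rest is built: the maximal
ideal is generated by the regular sequence \<open>x, y, z\<close>.\<close>

locale regular_triple = noetherian_local_ring +
  fixes x y z
  assumes closed [simp]: "x \<in> carrier R" "y \<in> carrier R" "z \<in> carrier R"
    and max_eq: "\<mm> = adjoin R (adjoin R (PIdl x) y) z"
    and x_regular: "r \<in> carrier R \<Longrightarrow> x \<otimes> r = \<zero> \<Longrightarrow> r = \<zero>"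
    and y_regular: "r \<in> carrier R \<Longrightarrow> y \<otimes> r \<in> PIdl x \<Longrightarrow> r \<in> PIdl x"
    and z_regular: "r \<in> carrier R \<Longrightarrow> z \<otimes> r \<in> adjoin R (PIdl x) y \<Longrightarrow> r \<in> adjoin R (PIdl x) y"

text \<open>The ideals \<open>0\<close>, \<open>(x)\<close> and \<open>(x, y)\<close> are prime, and the next parameter is outside of each.\<close>

lemma (in noetherian_local_ring) regular_triple_if_krull_dim_3:
  assumes c: "x \<in> carrier R" "y \<in> carrier R" "z \<in> carrier R"
    and gen: "Idl {x, y, z} = \<mm>" and dim: "krull_dim R = 3"
  shows "regular_triple R \<mm> x y z"
proof -
  have z0: "ideal {\<zero>} R" by (rule zeroideal)
  have xJ: "adjoin R {\<zero>} x = PIdl x" unfolding adjoin_def cgenideal_def using c(1)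
    by auto (metis l_zero m_closed)
  have xI: "ideal (PIdl x) R" by (rule cgenideal_ideal[OF c(1)])
  have yI: "ideal (adjoin R (PIdl x) y) R" by (rule adjoin_ideal[OF xI c(2)])
  have "\<mm> = Idl (insert z (insert y {x}))" using gen by (simp add: insert_commute)
  also have "\<dots> = adjoin R (adjoin R (PIdl x) y) z" using c by (simp add: adjoin_Idl cgenideal_eq_genideal)
  finally have max: "\<mm> = adjoin R (adjoin R (PIdl x) y) z" .
  have "krull_dim R = enat (Suc 2)" using dim by (simp add: numeral_eq_enat)
  then obtain p where p: "prime_chain R (length [x, y, z]) p"
    using krull_dim_attained[of R 2] unfolding length_Cons list.size(3) numeral_2_eq_2 by blast
  have p0: "{\<zero>} \<subseteq> p 0"
    using p additive_subgroup.zero_closed[of "p 0" R] unfolding prime_chain_def primeideal_def ideal_def by auto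
  have s0: "adjoin_list R {\<zero>} [x, y, z] = \<mm>" and s1: "adjoin_list R (PIdl x) [y, z] = \<mm>"
    and s2: "adjoin_list R (adjoin R (PIdl x) y) [z] = \<mm>" using max xJ by simp_all
  have cs: "set [x, y, z] \<subseteq> carrier R" "set [y, z] \<subseteq> carrier R" "set [z] \<subseteq> carrier R" using c by auto
  note pr0 = parameters_prime[OF z0 cs(1) s0 p p0]
  note st0 = parameters_first_step[OF z0 cs(1) s0 p p0]
  obtain q where q: "prime_chain R (length [y, z]) q" "PIdl x \<subseteq> q 0" using st0(2) unfolding xJ by blast
  note pr1 = parameters_prime[OF xI cs(2) s1 q]
  note st1 = parameters_first_step[OF xI cs(2) s1 q]
  obtain q' where q': "prime_chain R (length [z]) q'" "adjoin R (PIdl x) y \<subseteq> q' 0" using st1(2) by blast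
  note pr2 = parameters_prime[OF yI cs(3) s2 q']
  note st2 = parameters_first_step[OF yI cs(3) s2 q']
  show ?thesis
  proof
    show "x \<in> carrier R" "y \<in> carrier R" "z \<in> carrier R" by fact+
    show "\<mm> = adjoin R (adjoin R (PIdl x) y) z" by fact
    fix r assume r: "r \<in> carrier R"
    show "x \<otimes> r = \<zero> \<Longrightarrow> r = \<zero>" using primeideal.I_prime[OF pr0 c(1) r] st0(1) by auto
    show "y \<otimes> r \<in> PIdl x \<Longrightarrow> r \<in> PIdl x" using primeideal.I_prime[OF pr1 c(2) r] st1(1) by auto
    show "z \<otimes> r \<in> adjoin R (PIdl x) y \<Longrightarrow> r \<in> adjoin R (PIdl x) y"
      using primeideal.I_prime[OF pr2 c(3) r] st2(1) by auto
  qed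
qed

context regular_triple
begin

lemma x_ideal: "ideal (PIdl x) R" by (simp add: cgenideal_ideal)

lemmas x_minus = ideal_minus_closed[OF x_ideal]
lemmas x_add = ideal_add_closed[OF x_ideal]
lemmas x_mult = ideal.I_l_closed[OF x_ideal]
lemmas x_Icarr = ideal.Icarr[OF x_ideal]

lemma adjoin_x_ideal: "a \<in> carrier R \<Longrightarrow> ideal (adjoin R (PIdl x) a) R"
  by (rule adjoin_ideal[OF x_ideal])

lemma max_mem: "x \<in> \<mm>" "y \<in> \<mm>" "z \<in> \<mm>" "adjoin R (PIdl x) y \<subseteq> \<mm>"
proof -
  have 1: "adjoin R (PIdl x) y \<subseteq> \<mm>" and 2: "z \<in> \<mm>"
    unfolding max_eq using adjoin_superset[OF adjoin_x_ideal[of y], of z] adjoin_self[OF adjoin_x_ideal[of y], of z]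
    by auto
  then show "x \<in> \<mm>" "y \<in> \<mm>" "z \<in> \<mm>" "adjoin R (PIdl x) y \<subseteq> \<mm>"
    using adjoin_superset[OF x_ideal, of y] adjoin_self[OF x_ideal, of y] cgenideal_self[of x] by auto
qed

lemma x_cancel: "r \<in> carrier R \<Longrightarrow> s \<in> carrier R \<Longrightarrow> x \<otimes> r = x \<otimes> s \<Longrightarrow> r = s"
proof -
  assume r: "r \<in> carrier R" and s: "s \<in> carrier R" and eq: "x \<otimes> r = x \<otimes> s"
  have "x \<otimes> (r \<ominus> s) = x \<otimes> r \<ominus> x \<otimes> s" using r s closed by algebra
  also have "\<dots> = \<zero>" unfolding eq using s by (simp add: a_minus_def r_neg)
  finally have "r \<ominus> s = \<zero>" using x_regular r s by simp
  then show "r = s" using r s by simp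
qed

lemma y_pow_regular:
  assumes "r \<in> carrier R" "y [^] (n::nat) \<otimes> r \<in> PIdl x" shows "r \<in> PIdl x"
  using assms(2)
proof (induction n)
  case (Suc n)
  have "y [^] Suc n \<otimes> r = y \<otimes> (y [^] n \<otimes> r)" using assms(1) by (simp add: m_assoc m_lcomm)
  then show ?case using Suc y_regular[of "y [^] n \<otimes> r"] assms(1) by simp
qed (use assms(1) in simp)

lemma z_pow_regular_xy:
  assumes "r \<in> carrier R" "z [^] (n::nat) \<otimes> r \<in> adjoin R (PIdl x) y" shows "r \<in> adjoin R (PIdl x) y"
  using assms(2)
proof (induction n)
  case (Suc n)
  have "z [^] Suc n \<otimes> r = z \<otimes> (z [^] n \<otimes> r)" using assms(1) by (simp add: m_assoc m_lcomm)
  then show ?case using Suc z_regular[of "z [^] n \<otimes> r"] assms(1) by simp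
qed (use assms(1) in simp)

text \<open>Regularity of \<open>z\<close> modulo \<open>(x, y)\<close> passes to \<open>(x, y^b)\<close>: the powers of \<open>y\<close> filter
\<open>R / (x, y^b)\<close> with factors isomorphic to \<open>R / (x, y)\<close>.\<close>

lemma z_pow_regular:
  assumes "r \<in> carrier R" "z [^] (c::nat) \<otimes> r \<in> adjoin R (PIdl x) (y [^] (b::nat))"
  shows "r \<in> adjoin R (PIdl x) (y [^] b)"
  using assms
proof (induction b arbitrary: r)
  case 0
  have "r \<in> adjoin R (PIdl x) \<one>"
    using x_ideal 0 by (intro adjoin_diffI[of _ _ r])
      (simp_all add: a_minus_def r_neg additive_subgroup.zero_closed ideal.axioms(1))
  then show ?case by simp
next
  case (Suc b)
  define w where "w = z [^] c"
  define yb where "yb = y [^] b"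
  have c: "w \<in> carrier R" "yb \<in> carrier R" unfolding w_def yb_def by auto
  have "w \<otimes> r \<in> adjoin R (PIdl x) (yb \<otimes> y)" using Suc.prems(2) unfolding w_def yb_def by simp
  then obtain j t where jt: "j \<in> PIdl x" "t \<in> carrier R" "w \<otimes> r = j \<oplus> t \<otimes> (yb \<otimes> y)"
    by (rule adjoinE)
  have "j \<oplus> (t \<otimes> yb) \<otimes> y \<in> adjoin R (PIdl x) y" using jt(1,2) c by (intro adjoinI) auto
  then have "w \<otimes> r \<in> adjoin R (PIdl x) y" using jt(2) c by (simp add: jt(3) m_assoc)
  then have "r \<in> adjoin R (PIdl x) y" using z_pow_regular_xy Suc.prems(1) unfolding w_def by blast
  then obtain k s where ks: "k \<in> PIdl x" "s \<in> carrier R" "r = k \<oplus> s \<otimes> y" by (rule adjoinE)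
  have jk: "j \<in> carrier R" "k \<in> carrier R" using jt ks x_Icarr by auto
  have "y \<otimes> (w \<otimes> s \<ominus> t \<otimes> yb) = w \<otimes> (k \<oplus> s \<otimes> y) \<ominus> (j \<oplus> t \<otimes> (yb \<otimes> y)) \<oplus> (j \<ominus> w \<otimes> k)"
    using jk ks(2) jt(2) c closed by algebra
  also have "\<dots> = j \<ominus> w \<otimes> k"
    using Suc.prems(1) jk c by (simp add: ks(3)[symmetric] jt(3)[symmetric] a_minus_def r_neg)
  finally have "y \<otimes> (w \<otimes> s \<ominus> t \<otimes> yb) = j \<ominus> w \<otimes> k" .
  then have "w \<otimes> s \<ominus> t \<otimes> yb \<in> PIdl x"
    using jt(1) ks(1) c ks(2) jt(2) by - (rule y_regular, auto intro: x_minus x_mult)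
  then have "w \<otimes> s \<in> adjoin R (PIdl x) yb"
    using c ks(2) jt(2) x_ideal by (intro adjoin_diffI[of _ _ t]) auto
  then have "s \<in> adjoin R (PIdl x) yb" using Suc.IH[OF ks(2)] unfolding w_def yb_def by simp
  then obtain l u where lu: "l \<in> PIdl x" "u \<in> carrier R" "s = l \<oplus> u \<otimes> yb" by (rule adjoinE)
  have "l \<in> carrier R" using lu x_Icarr by auto
  then have "r = (k \<oplus> y \<otimes> l) \<oplus> u \<otimes> (yb \<otimes> y)" unfolding ks(3) lu(3) using jk lu(2) c closed by algebra
  moreover have "(k \<oplus> y \<otimes> l) \<oplus> u \<otimes> (yb \<otimes> y) \<in> adjoin R (PIdl x) (yb \<otimes> y)"
    using ks lu by (intro adjoinI x_add x_mult) auto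
  ultimately show ?case unfolding yb_def by simp
qed

text \<open>The monomial \<open>y^j z^l\<close> is not in \<open>(x, y^(j+1), z^(l+1))\<close>. For \<open>j = 0\<close>, cancelling \<open>z^l\<close>
modulo \<open>(x, y)\<close> would put a unit into \<open>(x, y)\<close>. For larger \<open>j\<close> the coefficient \<open>\<gamma>\<close> lies in
\<open>(x, y)\<close>, and one factor \<open>y\<close> cancels modulo \<open>x\<close>.\<close>

lemma monomial_not_in_multiples_mod_x:
  assumes "\<beta> \<in> carrier R" "\<gamma> \<in> carrier R"
  shows "y [^] j \<otimes> z [^] l \<ominus> \<beta> \<otimes> y [^] Suc j \<ominus> \<gamma> \<otimes> z [^] Suc l \<notin> PIdl x"
  using assms(2)
proof (induction j arbitrary: \<gamma>)
  case 0
  define w where "w = z [^] l"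
  have w: "w \<in> carrier R" unfolding w_def by simp
  show ?case
  proof
    assume "y [^] (0::nat) \<otimes> z [^] l \<ominus> \<beta> \<otimes> y [^] Suc 0 \<ominus> \<gamma> \<otimes> z [^] Suc l \<in> PIdl x"
    then have *: "w \<ominus> \<beta> \<otimes> y \<ominus> \<gamma> \<otimes> (w \<otimes> z) \<in> PIdl x" using w unfolding w_def by simp
    have "w \<otimes> (\<one> \<ominus> \<gamma> \<otimes> z) \<ominus> \<beta> \<otimes> y = w \<ominus> \<beta> \<otimes> y \<ominus> \<gamma> \<otimes> (w \<otimes> z)"
      using w assms(1) 0 closed by algebra
    then have "w \<otimes> (\<one> \<ominus> \<gamma> \<otimes> z) \<in> adjoin R (PIdl x) y"
      using * w assms(1) 0 x_ideal by (intro adjoin_diffI[of _ _ \<beta>]) auto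
    then have "\<one> \<ominus> \<gamma> \<otimes> z \<in> adjoin R (PIdl x) y" 
      using z_pow_regular_xy[of "\<one> \<ominus> \<gamma> \<otimes> z" l] 0 unfolding w_def by simp
    then have "\<one> \<ominus> \<gamma> \<otimes> z \<in> \<mm>" using max_mem(4) by blast
    then have "(\<one> \<ominus> \<gamma> \<otimes> z) \<oplus> \<gamma> \<otimes> z \<in> \<mm>"
      using max_mem(3) 0 ideal.I_l_closed[OF max_ideal] by (intro ideal_add_closed max_ideal) auto
    moreover have "(\<one> \<ominus> \<gamma> \<otimes> z) \<oplus> \<gamma> \<otimes> z = \<one>" using 0 closed by algebra
    ultimately show False using prime_one_not[OF max_prime] by simp
  qed
next
  case (Suc j)
  define w where "w = z [^] l"
  define u where "u = y [^] j"
  have c: "w \<in> carrier R" "u \<in> carrier R" unfolding w_def u_def by simp_all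
  show ?case
  proof
    assume "y [^] Suc j \<otimes> z [^] l \<ominus> \<beta> \<otimes> y [^] Suc (Suc j) \<ominus> \<gamma> \<otimes> z [^] Suc l \<in> PIdl x"
    then have *: "(u \<otimes> y) \<otimes> w \<ominus> \<beta> \<otimes> (u \<otimes> y \<otimes> y) \<ominus> \<gamma> \<otimes> (w \<otimes> z) \<in> PIdl x" (is "?E \<in> _")
      unfolding w_def u_def by simp
    have "(w \<otimes> z) \<otimes> \<gamma> \<ominus> (u \<otimes> w \<ominus> \<beta> \<otimes> (u \<otimes> y)) \<otimes> y = \<ominus> ?E"
      using c assms(1) Suc.prems closed by algebra
    moreover have "\<ominus> ?E \<in> PIdl x" by (rule additive_subgroup.a_inv_closed[OF ideal.axioms(1)[OF x_ideal] *])
    ultimately have "(w \<otimes> z) \<otimes> \<gamma> \<in> adjoin R (PIdl x) y"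
      using c assms(1) Suc.prems x_ideal by (intro adjoin_diffI[of _ _ "u \<otimes> w \<ominus> \<beta> \<otimes> (u \<otimes> y)"]) auto
    then have "\<gamma> \<in> adjoin R (PIdl x) y" using z_pow_regular_xy[of \<gamma> "Suc l"] Suc.prems unfolding w_def by simp
    then obtain k t where kt: "k \<in> PIdl x" "t \<in> carrier R" "\<gamma> = k \<oplus> t \<otimes> y" by (rule adjoinE)
    have k: "k \<in> carrier R" using kt x_Icarr by auto
    have "y \<otimes> (u \<otimes> w \<ominus> \<beta> \<otimes> (u \<otimes> y) \<ominus> t \<otimes> (w \<otimes> z)) = ?E \<oplus> (w \<otimes> z) \<otimes> k"
      unfolding kt(3) using c k kt(2) assms(1) closed by algebra
    moreover have "?E \<oplus> (w \<otimes> z) \<otimes> k \<in> PIdl x" using * kt(1) c by (intro x_add x_mult) auto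
    ultimately have "u \<otimes> w \<ominus> \<beta> \<otimes> (u \<otimes> y) \<ominus> t \<otimes> (w \<otimes> z) \<in> PIdl x"
      using c kt(2) assms(1) by - (rule y_regular, auto)
    then show False using Suc.IH[OF kt(2)] unfolding w_def u_def by simp
  qed
qed

text \<open>Modulo \<open>x\<close> the generators become \<open>- p' q\<close>, \<open>p p'\<close> and \<open>q q'\<close>. The regular sequence \<open>y, z\<close> behaves like
a pair of indeterminates, for which the syzygies of these monomials are generated by \<open>(p, q, 0)\<close>
and \<open>(q', 0, p')\<close>.\<close>

lemma syzygies_mod_x:
  fixes a2 a3 b2 b3 :: nat
  defines "p \<equiv> y [^] a2" and "p' \<equiv> y [^] b2" and "q \<equiv> z [^] a3" and "q' \<equiv> z [^] b3"
  assumes c: "\<alpha> \<in> carrier R" "\<beta> \<in> carrier R" "\<gamma> \<in> carrier R"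
    and rel: "\<beta> \<otimes> (p \<otimes> p') \<oplus> \<gamma> \<otimes> (q \<otimes> q') \<ominus> \<alpha> \<otimes> (p' \<otimes> q) \<in> PIdl x"
  shows "\<exists>\<sigma>\<in>carrier R. \<exists>\<tau>\<in>carrier R. \<alpha> \<ominus> (\<sigma> \<otimes> p \<oplus> \<tau> \<otimes> q') \<in> PIdl x
    \<and> \<beta> \<ominus> \<sigma> \<otimes> q \<in> PIdl x \<and> \<gamma> \<ominus> \<tau> \<otimes> p' \<in> PIdl x"
proof -
  have m[simp]: "p \<in> carrier R" "p' \<in> carrier R" "q \<in> carrier R" "q' \<in> carrier R"
    unfolding p_def p'_def q_def q'_def by auto
  have qq: "q \<otimes> q' = z [^] (a3 + b3)" unfolding q_def q'_def by (simp add: nat_pow_mult)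
  let ?E = "\<beta> \<otimes> (p \<otimes> p') \<oplus> \<gamma> \<otimes> (q \<otimes> q') \<ominus> \<alpha> \<otimes> (p' \<otimes> q)"
  have "(q \<otimes> q') \<otimes> \<gamma> \<ominus> (\<alpha> \<otimes> q \<ominus> \<beta> \<otimes> p) \<otimes> p' = ?E" using c m by algebra
  then have "(q \<otimes> q') \<otimes> \<gamma> \<in> adjoin R (PIdl x) p'"
    using rel c x_ideal by (intro adjoin_diffI[of _ _ "\<alpha> \<otimes> q \<ominus> \<beta> \<otimes> p"]) auto
  then have "\<gamma> \<in> adjoin R (PIdl x) p'" using z_pow_regular c(3) unfolding qq p'_def by blast
  then obtain k \<tau> where k: "k \<in> PIdl x" "\<tau> \<in> carrier R" "\<gamma> = k \<oplus> \<tau> \<otimes> p'" by (rule adjoinE)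
  have kc: "k \<in> carrier R" using k x_Icarr by auto
  have \<gamma>: "\<gamma> \<ominus> \<tau> \<otimes> p' = k" unfolding k(3) using kc k(2) m by algebra
  let ?F = "\<beta> \<otimes> p \<oplus> \<tau> \<otimes> (q \<otimes> q') \<ominus> \<alpha> \<otimes> q"
  have "p' \<otimes> ?F = ?E \<ominus> (q \<otimes> q') \<otimes> k" unfolding k(3) using c(1,2) kc k(2) m by algebra
  moreover have "?E \<ominus> (q \<otimes> q') \<otimes> k \<in> PIdl x" using x_minus[OF rel x_mult[OF k(1)]] by simp
  ultimately have F: "?F \<in> PIdl x" using c k(2) y_pow_regular[of ?F b2] unfolding p'_def[symmetric] by simp
  have Fc: "?F \<in> carrier R" using F x_Icarr by auto
  have "q \<otimes> (\<alpha> \<ominus> \<tau> \<otimes> q') \<ominus> \<beta> \<otimes> p = \<ominus> ?F" using c k(2) m by algebra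
  moreover have "\<ominus> ?F \<in> PIdl x" by (rule additive_subgroup.a_inv_closed[OF ideal.axioms(1)[OF x_ideal] F])
  ultimately have "q \<otimes> (\<alpha> \<ominus> \<tau> \<otimes> q') \<in> adjoin R (PIdl x) p"
    using c k(2) x_ideal by (intro adjoin_diffI[of _ _ \<beta>]) auto
  then have "\<alpha> \<ominus> \<tau> \<otimes> q' \<in> adjoin R (PIdl x) p"
    using z_pow_regular[of "\<alpha> \<ominus> \<tau> \<otimes> q'"] c(1) k(2) unfolding q_def p_def by simp
  then obtain l \<sigma> where l: "l \<in> PIdl x" "\<sigma> \<in> carrier R" "\<alpha> \<ominus> \<tau> \<otimes> q' = l \<oplus> \<sigma> \<otimes> p" by (rule adjoinE)
  have lc: "l \<in> carrier R" using l x_Icarr by auto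
  have "\<alpha> = (\<alpha> \<ominus> \<tau> \<otimes> q') \<oplus> \<tau> \<otimes> q'" using c k(2) m by algebra
  then have \<alpha>': "\<alpha> = l \<oplus> \<sigma> \<otimes> p \<oplus> \<tau> \<otimes> q'" unfolding l(3) .
  have \<alpha>: "\<alpha> \<ominus> (\<sigma> \<otimes> p \<oplus> \<tau> \<otimes> q') = l" unfolding \<alpha>' using lc l(2) k(2) m by algebra
  have "p \<otimes> (\<beta> \<ominus> \<sigma> \<otimes> q) = ?F \<oplus> q \<otimes> l" unfolding \<alpha>' using c(2) lc l(2) k(2) m by algebra
  moreover have "?F \<oplus> q \<otimes> l \<in> PIdl x" using x_add[OF F x_mult[OF l(1)]] by simp
  ultimately have "\<beta> \<ominus> \<sigma> \<otimes> q \<in> PIdl x"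
    using y_pow_regular[of "\<beta> \<ominus> \<sigma> \<otimes> q" a2] c(2) l(2) unfolding p_def by simp
  then show ?thesis using \<alpha> \<gamma> k(1,2) l(1,2) by auto
qed

end

section \<open>Weights and reduced monomials\<close>

locale hn_exponents =
  fixes a1 a2 a3 b1 b2 b3 :: nat
  assumes exponents_pos: "a1 > 0" "a2 > 0" "a3 > 0" "b1 > 0" "b2 > 0" "b3 > 0"
begin

abbreviation "c1 \<equiv> a1 + b1"
abbreviation "c2 \<equiv> a2 + b2"
abbreviation "c3 \<equiv> a3 + b3"

text \<open>These are the numbers \<open>c2 c3 - a2 b3\<close> etc., expanded so that no subtraction occurs. The form of
\<open>m1\<close> also shows the two rectangles that make up the staircase of reduced pairs.\<close>

definition m1 where "m1 = a2 * a3 + b2 * a3 + b2 * b3"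
definition m2 where "m2 = a1 * a3 + a1 * b3 + b1 * b3"
definition m3 where "m3 = a1 * a2 + b1 * a2 + b1 * b2"

lemma HN_m_eq: "HN_m (a1, a2, a3) (b1, b2, b3) = (m1, m2, m3)"
  by (simp add: m1_def m2_def m3_def Let_def algebra_simps)

lemma m_pos: "m1 > 0" "m2 > 0" "m3 > 0"
  using exponents_pos by (simp_all add: m1_def m2_def m3_def)

fun weight :: "nat \<times> nat \<times> nat \<Rightarrow> nat" where
  "weight (i, j, l) = i * m1 + j * m2 + l * m3"

text \<open>A triple \<open>(i, j, l)\<close> stands for \<open>x^i y^j z^l\<close>. The three rules read the generators \<open>v2\<close>, \<open>D\<close> and
\<open>v1\<close> as rewrite rules, directed so that the power of \<open>x\<close> grows.\<close>

inductive step :: "nat \<times> nat \<times> nat \<Rightarrow> nat \<times> nat \<times> nat \<Rightarrow> bool" where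
  step_y: "step (i, j + c2, l) (i + a1, j, l + b3)"
| step_z: "step (i, j, l + c3) (i + b1, j + a2, l)"
| step_yz: "step (i, j + b2, l + a3) (i + c1, j, l)"

lemma step_weight: "step s t \<Longrightarrow> weight t = weight s"
  by (induction rule: step.induct) (simp_all add: m1_def m2_def m3_def algebra_simps)

lemma steps_weight: "step\<^sup>*\<^sup>* s t \<Longrightarrow> weight t = weight s"
  by (induction rule: rtranclp_induct) (simp_all add: step_weight)

text \<open>The cells of the staircase: \<open>y^j z^l\<close> is divisible by no left-hand side of a rule.\<close>

definition reduced :: "nat \<Rightarrow> nat \<Rightarrow> bool" where
  "reduced j l \<longleftrightarrow> j < c2 \<and> l < c3 \<and> (j < b2 \<or> l < a3)"

lemma step_if_not_reduced:
  assumes "\<not> reduced j l" shows "\<exists>i' j' l'. step (i, j, l) (i', j', l') \<and> i < i'"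
proof -
  consider "j \<ge> c2" | "l \<ge> c3" | "j \<ge> b2" "l \<ge> a3" using assms unfolding reduced_def by linarith
  then show ?thesis
  proof cases
    case 1
    then show ?thesis using step_y[of i "j - c2" l] exponents_pos by fastforce
  next
    case 2
    then show ?thesis using step_z[of i j "l - c3"] exponents_pos by fastforce
  next
    case 3
    then show ?thesis using step_yz[of i "j - b2" "l - a3"] exponents_pos by fastforce
  qed
qed

text \<open>Rewriting keeps the weight and increases the exponent of \<open>x\<close>, which the weight bounds.\<close>

lemma reduced_form_exists: "\<exists>i' j' l'. step\<^sup>*\<^sup>* (i, j, l) (i', j', l') \<and> reduced j' l'"
proof (induction "weight (i, j, l) - i" arbitrary: i j l rule: less_induct)
  case less
  show ?case
  proof (cases "reduced j l")
    case False
    then obtain i' j' l' where s: "step (i, j, l) (i', j', l')" "i < i'" using step_if_not_reduced by blast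
    have "i' \<le> weight (i', j', l')" using m_pos(1) by (cases m1) auto
    then have "weight (i', j', l') - i' < weight (i, j, l) - i" using step_weight[OF s(1)] s(2) by linarith
    then show ?thesis using less s(1) by (meson converse_rtranclp_into_rtranclp)
  qed blast
qed

lemma card_reduced: "card {(j, l). reduced j l} = m1" "finite {(j, l). reduced j l}"
proof -
  have eq: "{(j, l). reduced j l} = {..<b2} \<times> {..<c3} \<union> {b2..<c2} \<times> {..<a3}"
    unfolding reduced_def by auto
  show "finite {(j, l). reduced j l}" unfolding eq by simp
  have "card {(j, l). reduced j l} = card ({..<b2} \<times> {..<c3}) + card ({b2..<c2} \<times> {..<a3})"
    unfolding eq by (intro card_Un_disjoint) auto
  then show "card {(j, l). reduced j l} = m1" by (simp add: m1_def algebra_simps)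
qed

end

locale hn_exponents_coprime = hn_exponents +
  assumes coprime: "gcd m1 (gcd m2 m3) = 1"
begin

text \<open>By Bezout, the residues of \<open>m2\<close> and \<open>m3\<close> generate all of \<open>\<int> / m1\<close>; the coefficients are made
nonnegative by reducing them modulo \<open>m1\<close>.\<close>

lemma residue_represented:
  assumes "r < m1" shows "\<exists>j l. (j * m2 + l * m3) mod m1 = r"
proof -
  define M where "M = int m1"
  have M: "M > 0" using m_pos unfolding M_def by simp
  obtain p q where pq: "p * int m2 + q * int m3 = gcd (int m2) (int m3)" using bezout_int by blast
  obtain u v where uv: "u * M + v * gcd (int m2) (int m3) = gcd M (gcd (int m2) (int m3))"
    using bezout_int by blast
  have "gcd M (gcd (int m2) (int m3)) = 1"
    unfolding M_def using coprime by (metis gcd_int_int_eq of_nat_1)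
  then have one: "v * p * int m2 + v * q * int m3 = 1 - u * M"
    using uv unfolding pq[symmetric] by (simp add: algebra_simps)
  define j where "j = (int r * v * p) mod M"
  define l where "l = (int r * v * q) mod M"
  have jl: "j \<ge> 0" "l \<ge> 0" unfolding j_def l_def using M by simp_all
  have "(j * int m2 + l * int m3) mod M = (int r * v * p * int m2 + int r * v * q * int m3) mod M"
    unfolding j_def l_def by (intro mod_add_cong mod_mult_cong) simp_all
  also have "int r * v * p * int m2 + int r * v * q * int m3 = int r * (v * p * int m2 + v * q * int m3)"
    by (simp add: algebra_simps)
  also have "\<dots> = int r + (- int r * u) * M" unfolding one by (simp add: algebra_simps)
  also have "\<dots> mod M = int r" using assms unfolding mod_mult_self1 by (simp add: M_def)
  finally have "int ((nat j * m2 + nat l * m3) mod m1) = int r"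
    using jl by (simp add: M_def zmod_int)
  then have "(nat j * m2 + nat l * m3) mod m1 = r" by linarith
  then show ?thesis by blast
qed

text \<open>A surjection between finite sets with \<open>m1\<close> elements each. It is onto because a pair can be
reduced without changing its weight modulo \<open>m1\<close>.\<close>

lemma reduced_weight_inj:
  "inj_on (\<lambda>(j, l). (j * m2 + l * m3) mod m1) {(j, l). reduced j l}" (is "inj_on ?f ?N")
proof (rule eq_card_imp_inj_on)
  show "finite ?N" by (rule card_reduced)
  have "?f ` ?N = {..<m1}"
  proof
    show "?f ` ?N \<subseteq> {..<m1}" using m_pos(1) by auto
    show "{..<m1} \<subseteq> ?f ` ?N"
    proof
      fix r assume "r \<in> {..<m1}"
      then obtain j l where jl: "(j * m2 + l * m3) mod m1 = r"
        using residue_represented[of r] by (auto simp: lessThan_iff)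
      obtain i' j' l' where n: "step\<^sup>*\<^sup>* (0, j, l) (i', j', l')" "reduced j' l'"
        using reduced_form_exists by blast
      have "j * m2 + l * m3 = i' * m1 + (j' * m2 + l' * m3)" using steps_weight[OF n(1)] by simp
      then have "(j' * m2 + l' * m3) mod m1 = r" using jl by simp
      then show "r \<in> ?f ` ?N" using n(2) by (intro image_eqI[of _ _ "(j', l')"]) auto
    qed
  qed
  then show "card (?f ` ?N) = card ?N" using card_reduced by simp
qed

lemma reduced_weight_unique:
  assumes "reduced j l" "reduced j' l'" and w: "weight (i, j, l) = weight (i', j', l')"
  shows "(i, j, l) = (i', j', l')"
proof -
  have "(i * m1 + (j * m2 + l * m3)) mod m1 = (i' * m1 + (j' * m2 + l' * m3)) mod m1"
    using w by (simp add: add.assoc)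
  then have "(j * m2 + l * m3) mod m1 = (j' * m2 + l' * m3) mod m1" by simp
  then have "(j, l) = (j', l')"
    using inj_onD[OF reduced_weight_inj, of "(j, l)" "(j', l')"] assms(1,2) by simp
  moreover have "i = i'" using calculation w m_pos(1) by simp
  ultimately show ?thesis by simp
qed

end

section \<open>Syzygies of Herzog--Northcott ideals\<close>

locale hn_ideal = regular_triple + hn_exponents
begin

definition v1 where "v1 = x [^] c1 \<ominus> y [^] b2 \<otimes> z [^] a3"
definition v2 where "v2 = y [^] c2 \<ominus> x [^] a1 \<otimes> z [^] b3"
definition D where "D = z [^] c3 \<ominus> x [^] b1 \<otimes> y [^] a2"

definition I where "I = Idl {v1, v2, D}"

lemma I_eq_HN_ideal: "I = HN_ideal R (x, y, z) (a1, a2, a3) (b1, b2, b3)"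
  unfolding I_def v1_def v2_def D_def by simp

lemma v_closed [simp]: "v1 \<in> carrier R" "v2 \<in> carrier R" "D \<in> carrier R"
  unfolding v1_def v2_def D_def by simp_all

lemma I_ideal: "ideal I R" unfolding I_def by (intro genideal_ideal) simp

lemma v_in_I: "v1 \<in> I" "v2 \<in> I" "D \<in> I"
  using genideal_self[of "{v1, v2, D}"] unfolding I_def by auto

lemmas I_minus = ideal_minus_closed[OF I_ideal]
lemmas I_add = ideal_add_closed[OF I_ideal]
lemmas I_mult = ideal.I_l_closed[OF I_ideal]
lemmas I_carr = ideal.Icarr[OF I_ideal]

lemma I_memE:
  assumes "f \<in> I"
  obtains \<alpha> \<beta> \<gamma> where "\<alpha> \<in> carrier R" "\<beta> \<in> carrier R" "\<gamma> \<in> carrier R"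
    "f = \<alpha> \<otimes> v1 \<oplus> \<beta> \<otimes> v2 \<oplus> \<gamma> \<otimes> D"
proof -
  have "I = adjoin R (adjoin R (PIdl D) v2) v1"
    unfolding I_def by (simp add: adjoin_Idl cgenideal_eq_genideal)
  then have "f \<in> adjoin R (adjoin R (PIdl D) v2) v1" using assms by simp
  then obtain g \<alpha> where 1: "g \<in> adjoin R (PIdl D) v2" "\<alpha> \<in> carrier R" "f = g \<oplus> \<alpha> \<otimes> v1" by (rule adjoinE)
  obtain h \<beta> where 2: "h \<in> PIdl D" "\<beta> \<in> carrier R" "g = h \<oplus> \<beta> \<otimes> v2" using 1(1) by (rule adjoinE)
  obtain \<gamma> where 3: "\<gamma> \<in> carrier R" "h = \<gamma> \<otimes> D" using 2(1) by (rule cgenidealE)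
  have "f = \<alpha> \<otimes> v1 \<oplus> \<beta> \<otimes> v2 \<oplus> \<gamma> \<otimes> D"
    unfolding 1(3) 2(3) 3(2) using 1(2) 2(2) 3(1) v_closed by algebra
  then show thesis using that 1(2) 2(2) 3(1) by blast
qed

text \<open>One factor \<open>x\<close> is split off wherever \<open>x\<close> occurs, to make reduction modulo \<open>x\<close> visible.\<close>

lemma v_factored:
  "v1 = (x \<otimes> x [^] (a1 - 1)) \<otimes> (x \<otimes> x [^] (b1 - 1)) \<ominus> y [^] b2 \<otimes> z [^] a3"
  "v2 = y [^] a2 \<otimes> y [^] b2 \<ominus> (x \<otimes> x [^] (a1 - 1)) \<otimes> z [^] b3"
  "D = z [^] a3 \<otimes> z [^] b3 \<ominus> (x \<otimes> x [^] (b1 - 1)) \<otimes> y [^] a2"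
proof -
  have xa: "x [^] a1 = x \<otimes> x [^] (a1 - 1)" "x [^] b1 = x \<otimes> x [^] (b1 - 1)"
    using exponents_pos nat_pow_Suc2[OF closed(1)] by (metis Suc_pred' One_nat_def)+
  show "v1 = (x \<otimes> x [^] (a1 - 1)) \<otimes> (x \<otimes> x [^] (b1 - 1)) \<ominus> y [^] b2 \<otimes> z [^] a3"
    "v2 = y [^] a2 \<otimes> y [^] b2 \<ominus> (x \<otimes> x [^] (a1 - 1)) \<otimes> z [^] b3"
    "D = z [^] a3 \<otimes> z [^] b3 \<ominus> (x \<otimes> x [^] (b1 - 1)) \<otimes> y [^] a2"
    unfolding v1_def v2_def D_def nat_pow_mult[OF closed(1), symmetric] nat_pow_mult[OF closed(2), symmetric]
      nat_pow_mult[OF closed(3), symmetric] xa[symmetric] by simp_all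
qed

lemma I_syzygy:
  assumes c: "\<alpha> \<in> carrier R" "\<beta> \<in> carrier R" "\<gamma> \<in> carrier R"
    and rel: "\<alpha> \<otimes> v1 \<oplus> \<beta> \<otimes> v2 \<oplus> \<gamma> \<otimes> D \<in> PIdl x"
  shows "\<exists>\<sigma>\<in>carrier R. \<exists>\<tau>\<in>carrier R. \<alpha> \<ominus> (\<sigma> \<otimes> y [^] a2 \<oplus> \<tau> \<otimes> z [^] b3) \<in> PIdl x
    \<and> \<beta> \<ominus> \<sigma> \<otimes> z [^] a3 \<in> PIdl x \<and> \<gamma> \<ominus> \<tau> \<otimes> y [^] b2 \<in> PIdl x"
proof (rule syzygies_mod_x[OF c])
  define p p' q q' u u' where d: "p = y [^] a2" "p' = y [^] b2" "q = z [^] a3" "q' = z [^] b3"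
    "u = x [^] (a1 - 1)" "u' = x [^] (b1 - 1)"
  have m: "p \<in> carrier R" "p' \<in> carrier R" "q \<in> carrier R" "q' \<in> carrier R" "u \<in> carrier R" "u' \<in> carrier R"
    unfolding d by auto
  have v: "v1 = (x \<otimes> u) \<otimes> (x \<otimes> u') \<ominus> p' \<otimes> q" "v2 = p \<otimes> p' \<ominus> (x \<otimes> u) \<otimes> q'"
    "D = q \<otimes> q' \<ominus> (x \<otimes> u') \<otimes> p"
    unfolding d by (rule v_factored)+
  let ?h = "\<beta> \<otimes> (u \<otimes> q') \<oplus> \<gamma> \<otimes> (u' \<otimes> p) \<ominus> \<alpha> \<otimes> (u \<otimes> (x \<otimes> u'))"
  have "\<beta> \<otimes> (p \<otimes> p') \<oplus> \<gamma> \<otimes> (q \<otimes> q') \<ominus> \<alpha> \<otimes> (p' \<otimes> q)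
      = (\<alpha> \<otimes> v1 \<oplus> \<beta> \<otimes> v2 \<oplus> \<gamma> \<otimes> D) \<oplus> ?h \<otimes> x"
    unfolding v using c m closed by algebra
  also have "\<dots> \<in> PIdl x" using c m by (intro x_add[OF rel] cgenidealI) auto
  finally show "\<beta> \<otimes> (y [^] a2 \<otimes> y [^] b2) \<oplus> \<gamma> \<otimes> (z [^] a3 \<otimes> z [^] b3) \<ominus> \<alpha> \<otimes> (y [^] b2 \<otimes> z [^] a3)
      \<in> PIdl x" unfolding d .
qed

text \<open>A syzygy is congruent modulo \<open>x\<close> to a combination of the two rows of the matrix, and their entries
are positive powers of parameters.\<close>

lemma I_syzygy_in_max:
  assumes c: "\<alpha> \<in> carrier R" "\<beta> \<in> carrier R" "\<gamma> \<in> carrier R"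
    and rel: "\<alpha> \<otimes> v1 \<oplus> \<beta> \<otimes> v2 \<oplus> \<gamma> \<otimes> D = \<zero>"
  shows "\<alpha> \<in> \<mm>" "\<beta> \<in> \<mm>" "\<gamma> \<in> \<mm>"
proof -
  have "\<zero> \<in> PIdl x" using x_ideal by (simp add: additive_subgroup.zero_closed ideal.axioms(1))
  then obtain \<sigma> \<tau> where s: "\<sigma> \<in> carrier R" "\<tau> \<in> carrier R"
    and e: "\<alpha> \<ominus> (\<sigma> \<otimes> y [^] a2 \<oplus> \<tau> \<otimes> z [^] b3) \<in> PIdl x" "\<beta> \<ominus> \<sigma> \<otimes> z [^] a3 \<in> PIdl x"
      "\<gamma> \<ominus> \<tau> \<otimes> y [^] b2 \<in> PIdl x"
    using I_syzygy[OF c] unfolding rel by blast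
  have pw: "r [^] n \<in> \<mm>" if "r \<in> \<mm>" "n > 0" for r and n :: nat
    using that ideal.I_l_closed[OF max_ideal, of r "r [^] (n - 1)"] ideal.Icarr[OF max_ideal, of r]
    by (cases n) auto
  have x: "PIdl x \<subseteq> \<mm>" using cgenideal_minimal[OF max_ideal max_mem(1)] .
  have from_x: "u \<in> \<mm>" if "u \<ominus> w \<in> PIdl x" "w \<in> \<mm>" "u \<in> carrier R" for u w
  proof -
    have wc: "w \<in> carrier R" using that(2) max_subset_carrier by blast
    have "u = (u \<ominus> w) \<oplus> w" using that(3) wc by algebra
    then show ?thesis using ideal_add_closed[OF max_ideal, of "u \<ominus> w" w] that(1,2) x by auto
  qed
  note ml = ideal.I_l_closed[OF max_ideal pw]
  show "\<alpha> \<in> \<mm>" using ml[OF max_mem(2) exponents_pos(2) s(1)] ml[OF max_mem(3) exponents_pos(6) s(2)]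
    by (intro from_x[OF e(1) _ c(1)] ideal_add_closed max_ideal)
  show "\<beta> \<in> \<mm>" using ml[OF max_mem(3) exponents_pos(3) s(1)] by (intro from_x[OF e(2) _ c(2)])
  show "\<gamma> \<in> \<mm>" using ml[OF max_mem(2) exponents_pos(5) s(2)] by (intro from_x[OF e(3) _ c(3)])
qed

text \<open>Write \<open>x f\<close> in terms of the generators. Its coefficients are, up to multiples of \<open>x\<close>, a combination of
the two vectors of \<open>syzygies_mod_x\<close>. By the relations between the minors of the matrix
(\<open>row1\<close>, \<open>row2\<close>), both vectors give elements of \<open>x I\<close>, so \<open>x\<close> cancels.\<close>

lemma I_x_regular:
  assumes f: "f \<in> carrier R" and xf: "x \<otimes> f \<in> I" shows "f \<in> I"
proof -
  define p p' q q' u u' where d: "p = y [^] a2" "p' = y [^] b2" "q = z [^] a3" "q' = z [^] b3"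
    "u = x [^] (a1 - 1)" "u' = x [^] (b1 - 1)"
  have m: "p \<in> carrier R" "p' \<in> carrier R" "q \<in> carrier R" "q' \<in> carrier R" "u \<in> carrier R" "u' \<in> carrier R"
    unfolding d by auto
  have v: "v1 = (x \<otimes> u) \<otimes> (x \<otimes> u') \<ominus> p' \<otimes> q" "v2 = p \<otimes> p' \<ominus> (x \<otimes> u) \<otimes> q'"
    "D = q \<otimes> q' \<ominus> (x \<otimes> u') \<otimes> p"
    unfolding d by (rule v_factored)+
  have row1: "p \<otimes> v1 \<oplus> q \<otimes> v2 = x \<otimes> (\<ominus> (u \<otimes> D))" unfolding v using m closed by algebra
  have row2: "q' \<otimes> v1 \<oplus> p' \<otimes> D = x \<otimes> (\<ominus> (u' \<otimes> v2))" unfolding v using m closed by algebra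
  obtain \<alpha> \<beta> \<gamma> where c: "\<alpha> \<in> carrier R" "\<beta> \<in> carrier R" "\<gamma> \<in> carrier R"
    and rel: "x \<otimes> f = \<alpha> \<otimes> v1 \<oplus> \<beta> \<otimes> v2 \<oplus> \<gamma> \<otimes> D"
    using xf by (rule I_memE)
  have "x \<otimes> f \<in> PIdl x" using f cgenidealI[of f x] m_comm by simp
  then obtain \<sigma> \<tau> where s: "\<sigma> \<in> carrier R" "\<tau> \<in> carrier R"
    and e: "\<alpha> \<ominus> (\<sigma> \<otimes> p \<oplus> \<tau> \<otimes> q') \<in> PIdl x" "\<beta> \<ominus> \<sigma> \<otimes> q \<in> PIdl x" "\<gamma> \<ominus> \<tau> \<otimes> p' \<in> PIdl x"
    using I_syzygy[OF c] unfolding rel d(1-4) by blast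
  obtain r1 where r1: "r1 \<in> carrier R" "\<alpha> \<ominus> (\<sigma> \<otimes> p \<oplus> \<tau> \<otimes> q') = r1 \<otimes> x" using e(1) by (rule cgenidealE)
  obtain r2 where r2: "r2 \<in> carrier R" "\<beta> \<ominus> \<sigma> \<otimes> q = r2 \<otimes> x" using e(2) by (rule cgenidealE)
  obtain r3 where r3: "r3 \<in> carrier R" "\<gamma> \<ominus> \<tau> \<otimes> p' = r3 \<otimes> x" using e(3) by (rule cgenidealE)
  let ?g = "r1 \<otimes> v1 \<oplus> r2 \<otimes> v2 \<oplus> r3 \<otimes> D \<ominus> \<sigma> \<otimes> (u \<otimes> D) \<ominus> \<tau> \<otimes> (u' \<otimes> v2)"
  have "x \<otimes> f = (\<alpha> \<ominus> (\<sigma> \<otimes> p \<oplus> \<tau> \<otimes> q')) \<otimes> v1 \<oplus> (\<beta> \<ominus> \<sigma> \<otimes> q) \<otimes> v2 \<oplus> (\<gamma> \<ominus> \<tau> \<otimes> p') \<otimes> D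
      \<oplus> \<sigma> \<otimes> (p \<otimes> v1 \<oplus> q \<otimes> v2) \<oplus> \<tau> \<otimes> (q' \<otimes> v1 \<oplus> p' \<otimes> D)"
    unfolding rel using c s m v_closed by algebra
  also have "\<dots> = x \<otimes> ?g"
    unfolding r1(2) r2(2) r3(2) row1 row2 using r1(1) r2(1) r3(1) s m v_closed closed by algebra
  finally have "f = ?g" using f r1(1) r2(1) r3(1) s m by - (rule x_cancel, auto)
  also have "?g \<in> I" using r1(1) r2(1) r3(1) s m v_in_I by (intro I_minus I_add I_mult) auto
  finally show ?thesis .
qed

end

section \<open>The weight filtration\<close>

context hn_ideal
begin

fun mon :: "nat \<times> nat \<times> nat \<Rightarrow> 'a" where
  "mon (i, j, l) = x [^] i \<otimes> (y [^] j \<otimes> z [^] l)"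

lemma mon_closed [simp]: "mon t \<in> carrier R" by (cases t) simp

lemma mon_mult: "mon (i, j, l) \<otimes> mon (i', j', l') = mon (i + i', j + j', l + l')"
proof -
  define p p' q q' r r' where d: "p = x [^] i" "p' = x [^] i'" "q = y [^] j" "q' = y [^] j'"
    "r = z [^] l" "r' = z [^] l'"
  have m: "p \<in> carrier R" "p' \<in> carrier R" "q \<in> carrier R" "q' \<in> carrier R" "r \<in> carrier R" "r' \<in> carrier R"
    unfolding d by auto
  have "p \<otimes> (q \<otimes> r) \<otimes> (p' \<otimes> (q' \<otimes> r')) = (p \<otimes> p') \<otimes> ((q \<otimes> q') \<otimes> (r \<otimes> r'))" using m by algebra
  then show ?thesis unfolding d by (simp add: nat_pow_mult)
qed

lemma x_mon: "x \<otimes> mon (i, j, l) = mon (Suc i, j, l)"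
  using mon_mult[of 1 0 0 i j l] by simp

lemma v_mon: "v1 = mon (c1, 0, 0) \<ominus> mon (0, b2, a3)" "v2 = mon (0, c2, 0) \<ominus> mon (a1, 0, b3)"
  "D = mon (0, 0, c3) \<ominus> mon (b1, a2, 0)"
  unfolding v1_def v2_def D_def by simp_all

declare mon.simps [simp del]

lemma step_congruent: "step s t \<Longrightarrow> mon s \<ominus> mon t \<in> I"
proof (induction rule: step.induct)
  case (step_y i j l)
  have "mon (i, j, l) \<otimes> v2 = mon (i, j, l) \<otimes> mon (0, c2, 0) \<ominus> mon (i, j, l) \<otimes> mon (a1, 0, b3)"
    unfolding v_mon using mon_closed by algebra
  then show ?case using I_mult[OF v_in_I(2) mon_closed, of "(i, j, l)"] unfolding mon_mult by simp
next
  case (step_z i j l)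
  have "mon (i, j, l) \<otimes> D = mon (i, j, l) \<otimes> mon (0, 0, c3) \<ominus> mon (i, j, l) \<otimes> mon (b1, a2, 0)"
    unfolding v_mon using mon_closed by algebra
  then show ?case using I_mult[OF v_in_I(3) mon_closed, of "(i, j, l)"] unfolding mon_mult by simp
next
  case (step_yz i j l)
  have "\<ominus> mon (i, j, l) \<otimes> v1 = mon (i, j, l) \<otimes> mon (0, b2, a3) \<ominus> mon (i, j, l) \<otimes> mon (c1, 0, 0)"
    unfolding v_mon using mon_closed by algebra
  then show ?case using I_mult[OF v_in_I(1), of "\<ominus> mon (i, j, l)"] unfolding mon_mult by simp
qed

text \<open>Hence monomials with the same reduced form agree modulo \<open>I\<close>.\<close>

lemma steps_congruent: "step\<^sup>*\<^sup>* s t \<Longrightarrow> mon s \<ominus> mon t \<in> I"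
proof (induction rule: rtranclp_induct)
  case base
  have eq: "mon s \<ominus> mon s = \<zero>" by (simp add: a_minus_def r_neg)
  show ?case unfolding eq by (rule additive_subgroup.zero_closed[OF ideal.axioms(1)[OF I_ideal]])
next
  case (step t u)
  have "mon s \<ominus> mon u = (mon s \<ominus> mon t) \<oplus> (mon t \<ominus> mon u)" using mon_closed by algebra
  then show ?case using I_add[OF step.IH step_congruent[OF step.hyps(2)]] by simp
qed

text \<open>The generators of \<open>I\<close> are included, so that the filtration of \<open>R\<close> describes the one induced on
\<open>R / I\<close>.\<close>

definition F_gens where "F_gens n = {v1, v2, D} \<union> mon ` {t. weight t \<ge> n}"
definition F where "F n = Idl (F_gens n)"

lemma F_gens_closed: "F_gens n \<subseteq> carrier R" unfolding F_gens_def by auto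

lemma F_ideal: "ideal (F n) R" unfolding F_def by (rule genideal_ideal[OF F_gens_closed])

lemmas F_minus = ideal_minus_closed[OF F_ideal]
lemmas F_add = ideal_add_closed[OF F_ideal]
lemmas F_mult = ideal.I_l_closed[OF F_ideal]
lemmas F_carr = ideal.Icarr[OF F_ideal]

lemma F_minimal:
  assumes "ideal J R" "I \<subseteq> J" "\<And>t. weight t \<ge> n \<Longrightarrow> mon t \<in> J"
  shows "F n \<subseteq> J"
  unfolding F_def
proof (rule genideal_minimal[OF assms(1)])
  have "{v1, v2, D} \<subseteq> J" using assms(2) v_in_I by blast
  moreover have "mon ` {t. weight t \<ge> n} \<subseteq> J" using assms(3) by blast
  ultimately show "F_gens n \<subseteq> J" unfolding F_gens_def by (rule Un_least)
qed

lemma F_gens_subset_F: "F_gens n \<subseteq> F n"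
  unfolding F_def by (rule genideal_self[OF F_gens_closed])

lemma mon_in_F: "n \<le> weight t \<Longrightarrow> mon t \<in> F n"
  by (rule subsetD[OF F_gens_subset_F]) (simp add: F_gens_def del: weight.simps)

lemma I_subset_F: "I \<subseteq> F n"
  unfolding I_def
proof (rule genideal_minimal[OF F_ideal])
  show "{v1, v2, D} \<subseteq> F n" using F_gens_subset_F[of n] unfolding F_gens_def by (rule le_supE)
qed

lemma F_antimono: "n \<le> k \<Longrightarrow> F k \<subseteq> F n"
  by (intro F_minimal F_ideal I_subset_F mon_in_F) simp

lemma F_0: "F 0 = carrier R"
  using mon_in_F[of 0 "(0, 0, 0)"] ideal.one_imp_carrier[OF F_ideal[of 0]] by (simp add: mon.simps)

lemma F_mono_mult: assumes "g \<in> F k" shows "g \<otimes> mon t \<in> F (k + weight t)"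
proof -
  have "F k \<subseteq> {r \<in> carrier R. r \<otimes> mon t \<in> F (k + weight t)}"
  proof (intro F_minimal colon_ideal F_ideal mon_closed)
    show "I \<subseteq> {r \<in> carrier R. r \<otimes> mon t \<in> F (k + weight t)}"
      by (auto intro: I_carr intro!: subsetD[OF I_subset_F] ideal.I_r_closed[OF I_ideal _ mon_closed])
    fix s assume s: "k \<le> weight s"
    obtain i j l i' j' l' where e: "s = (i, j, l)" "t = (i', j', l')" by (cases s, cases t) auto
    have "mon s \<otimes> mon t \<in> F (k + weight t)"
      unfolding e mon_mult using s by (intro mon_in_F) (simp add: e algebra_simps)
    then show "mon s \<in> {r \<in> carrier R. r \<otimes> mon t \<in> F (k + weight t)}" by simp
  qed
  then show ?thesis using assms by blast
qed

lemma F_mult_F: assumes f: "f \<in> F n" and g: "g \<in> F k" shows "f \<otimes> g \<in> F (n + k)"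
proof -
  have gc: "g \<in> carrier R" using F_carr[OF g] .
  have "F n \<subseteq> {r \<in> carrier R. r \<otimes> g \<in> F (n + k)}"
  proof (intro F_minimal colon_ideal F_ideal gc)
    show "I \<subseteq> {r \<in> carrier R. r \<otimes> g \<in> F (n + k)}"
      using gc by (auto intro: I_carr subsetD[OF I_subset_F] ideal.I_r_closed[OF I_ideal])
    fix s assume s: "n \<le> weight s"
    have "mon s \<otimes> g \<in> F (k + weight s)" using F_mono_mult[OF g] m_comm[OF gc mon_closed] by simp
    then show "mon s \<in> {r \<in> carrier R. r \<otimes> g \<in> F (n + k)}"
      using F_antimono[of "n + k" "k + weight s"] s by auto
  qed
  then show ?thesis using f by blast
qed

lemma max_mult_mon: assumes "r \<in> \<mm>" shows "r \<otimes> mon t \<in> F (Suc (weight t))"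
proof -
  let ?J = "{r \<in> carrier R. r \<otimes> mon t \<in> F (Suc (weight t))}"
  have J: "ideal ?J R" by (intro colon_ideal F_ideal mon_closed)
  obtain i j l where t: "t = (i, j, l)" by (cases t) auto
  have "x = mon (1, 0, 0)" "y = mon (0, 1, 0)" "z = mon (0, 0, 1)" by (simp_all add: mon.simps)
  then have "x \<otimes> mon t = mon (1 + i, j, l)" "y \<otimes> mon t = mon (i, 1 + j, l)" "z \<otimes> mon t = mon (i, j, 1 + l)"
    unfolding t by (metis mon_mult add_0)+
  then have "x \<in> ?J" "y \<in> ?J" "z \<in> ?J"
    using m_pos by (auto simp: t intro!: mon_in_F)
  then have "\<mm> \<subseteq> ?J"
    unfolding max_eq by (intro adjoin_minimal[OF J] cgenideal_minimal[OF J])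
  then show ?thesis using assms by blast
qed

text \<open>A reduced monomial \<open>y^j z^l\<close> is outside of \<open>(x) + F n\<close> for \<open>n\<close> above its weight. This ideal
is contained in \<open>(x, y^(j+1), z^(l+1))\<close>: a monomial of larger weight has a larger exponent
somewhere, and so has each monomial of a generator, because \<open>(j, l)\<close> is in the staircase.\<close>

lemma F_reduced_yz:
  assumes "reduced j l" "n > weight (0, j, l)"
  shows "F n \<subseteq> adjoin R (adjoin R (PIdl x) (y [^] Suc j)) (z [^] Suc l)" (is "_ \<subseteq> ?B")
    and "y [^] j \<otimes> z [^] l \<notin> adjoin R (adjoin R (PIdl x) (y [^] Suc j)) (z [^] Suc l)"
    and "PIdl x \<subseteq> adjoin R (adjoin R (PIdl x) (y [^] Suc j)) (z [^] Suc l)"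
    and "ideal (adjoin R (adjoin R (PIdl x) (y [^] Suc j)) (z [^] Suc l)) R"
proof -
  have A: "ideal (adjoin R (PIdl x) (y [^] Suc j)) R" by (rule adjoin_x_ideal) simp
  have yc: "y [^] Suc j \<in> carrier R" and zc: "z [^] Suc l \<in> carrier R" by simp_all
  show B: "ideal ?B R" by (rule adjoin_ideal[OF A zc])
  show xB: "PIdl x \<subseteq> ?B" using adjoin_superset[OF x_ideal yc] adjoin_superset[OF A zc] by blast
  have "y [^] Suc j \<in> ?B" using adjoin_self[OF x_ideal yc] adjoin_superset[OF A zc] by blast
  moreover have "mon (0, Suc j, 0) = y [^] Suc j" "mon (0, 0, Suc l) = z [^] Suc l"
    using yc zc by (simp_all only: mon.simps nat_pow_0 one_closed l_one r_one)
  ultimately have yB: "mon (0, Suc j, 0) \<in> ?B" and zB: "mon (0, 0, Suc l) \<in> ?B"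
    using adjoin_self[OF A zc] by simp_all
  have xxB: "x \<in> ?B" using xB cgenideal_self[OF closed(1)] by blast
  note Bm = ideal.I_l_closed[OF B] and Br = ideal.I_r_closed[OF B]
  have mon_B: "mon (i', j', l') \<in> ?B" if d: "i' > 0 \<or> j' > j \<or> l' > l" for i' j' l'
  proof -
    have 1: "mon (i', j', l') \<in> ?B" if "i' > 0"
    proof -
      have "mon (i', j', l') = x \<otimes> mon (i' - 1, j', l')" using x_mon[of "i' - 1"] that by simp
      then show ?thesis using Br[OF xxB mon_closed, of "(i' - 1, j', l')"] by simp
    qed
    have 2: "mon (i', j', l') \<in> ?B" if "j' > j"
    proof -
      have "mon (i', j', l') = mon (i', j' - Suc j, l') \<otimes> mon (0, Suc j, 0)"
        using mon_mult[of i' "j' - Suc j" l' 0 "Suc j" 0] that by simp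
      then show ?thesis using Bm[OF yB mon_closed, of "(i', j' - Suc j, l')"] by simp
    qed
    have 3: "mon (i', j', l') \<in> ?B" if "l' > l"
    proof -
      have "mon (i', j', l') = mon (i', j', l' - Suc l) \<otimes> mon (0, 0, Suc l)"
        using mon_mult[of i' j' "l' - Suc l" 0 0 "Suc l"] that by simp
      then show ?thesis using Bm[OF zB mon_closed, of "(i', j', l' - Suc l)"] by simp
    qed
    show ?thesis using d 1 2 3 by blast
  qed
  show "F n \<subseteq> ?B"
  proof (rule F_minimal[OF B])
    have "v1 \<in> ?B" "v2 \<in> ?B" "D \<in> ?B"
      unfolding v_mon using assms(1) exponents_pos
      by (intro ideal_minus_closed[OF B] mon_B; auto simp: reduced_def)+
    then show "I \<subseteq> ?B" unfolding I_def by (intro genideal_minimal[OF B]) simp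
    fix t assume t: "n \<le> weight t"
    obtain i' j' l' where e: "t = (i', j', l')" by (cases t) auto
    have "i' > 0 \<or> j' > j \<or> l' > l"
    proof (rule ccontr)
      assume "\<not> ?thesis"
      then have "i' * m1 = 0" "j' * m2 \<le> j * m2" "l' * m3 \<le> l * m3" by (auto intro: mult_le_mono1)
      moreover have "n \<le> i' * m1 + j' * m2 + l' * m3" "j * m2 + l * m3 < n"
        using t assms(2) by (simp_all add: e)
      ultimately show False by linarith
    qed
    then show "mon t \<in> ?B" unfolding e by (rule mon_B)
  qed
  show "y [^] j \<otimes> z [^] l \<notin> ?B"
  proof
    assume "y [^] j \<otimes> z [^] l \<in> ?B"
    then obtain g \<gamma> where g: "g \<in> adjoin R (PIdl x) (y [^] Suc j)" "\<gamma> \<in> carrier R"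
      "y [^] j \<otimes> z [^] l = g \<oplus> \<gamma> \<otimes> z [^] Suc l" by (rule adjoinE)
    obtain k \<beta> where k: "k \<in> PIdl x" "\<beta> \<in> carrier R" "g = k \<oplus> \<beta> \<otimes> y [^] Suc j" using g(1) by (rule adjoinE)
    have kc: "k \<in> carrier R" using k x_Icarr by auto
    have "k \<oplus> \<beta> \<otimes> y [^] Suc j \<oplus> \<gamma> \<otimes> z [^] Suc l \<ominus> \<beta> \<otimes> y [^] Suc j \<ominus> \<gamma> \<otimes> z [^] Suc l = k"
      using kc k(2) g(2) yc zc by algebra
    then have "y [^] j \<otimes> z [^] l \<ominus> \<beta> \<otimes> y [^] Suc j \<ominus> \<gamma> \<otimes> z [^] Suc l = k"
      unfolding g(3) k(3) .
    then show False using monomial_not_in_multiples_mod_x[OF k(2) g(2), of j l] k(1) by simp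
  qed
qed

text \<open>A reduced monomial of weight at least \<open>n + bound\<close> has a factor \<open>x\<close>, and dividing by it leaves
weight at least \<open>n\<close>.\<close>

definition bound where "bound = m1 + c2 * m2 + c3 * m3"

lemma F_deep:
  assumes "g \<in> F (n + bound)" shows "\<exists>k\<in>F n. g \<ominus> x \<otimes> k \<in> I"
proof -
  \<comment> \<open>The elements with the desired property form an ideal, so only generators need to be checked.\<close>
  define T where "T = {g \<in> carrier R. \<exists>k\<in>F n. g \<ominus> x \<otimes> k \<in> I}"
  have zero: "\<zero> \<in> I" "\<zero> \<in> F n"
    using I_ideal F_ideal[of n] by (simp_all add: additive_subgroup.zero_closed ideal.axioms(1))
  have mem: "g \<in> T" if "g \<in> carrier R" "k \<in> F n" "g \<ominus> x \<otimes> k \<in> I" for g k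
    using that unfolding T_def by blast
  have T: "ideal T R"
  proof (rule idealI[OF ring_axioms])
    show "subgroup T (add_monoid R)"
    proof (rule group.subgroupI)
      show "Group.group (add_monoid R)" by (rule add.is_group)
      show "T \<subseteq> carrier (add_monoid R)" unfolding T_def by auto
      have "\<zero> \<in> T" using zero by (intro mem[of _ \<zero>]) (auto simp: a_minus_def)
      then show "T \<noteq> {}" by blast
      fix a assume "a \<in> T"
      then obtain k where k: "a \<in> carrier R" "k \<in> F n" "a \<ominus> x \<otimes> k \<in> I" unfolding T_def by blast
      have kc: "k \<in> carrier R" using F_carr[OF k(2)] .
      have "\<ominus> a \<ominus> x \<otimes> (\<ominus> k) = \<ominus> (a \<ominus> x \<otimes> k)" using k(1) kc closed by algebra
      also have "\<dots> \<in> I" by (rule additive_subgroup.a_inv_closed[OF ideal.axioms(1)[OF I_ideal] k(3)])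
      finally have "\<ominus> a \<in> T"
        using k(1) additive_subgroup.a_inv_closed[OF ideal.axioms(1)[OF F_ideal] k(2)] by (intro mem[of _ "\<ominus> k"]) auto
      then show "inv\<^bsub>add_monoid R\<^esub> a \<in> T" unfolding a_inv_def .
      fix b assume "b \<in> T"
      then obtain h where h: "b \<in> carrier R" "h \<in> F n" "b \<ominus> x \<otimes> h \<in> I" unfolding T_def by blast
      have hc: "h \<in> carrier R" using F_carr[OF h(2)] .
      have "a \<oplus> b \<ominus> x \<otimes> (k \<oplus> h) = (a \<ominus> x \<otimes> k) \<oplus> (b \<ominus> x \<otimes> h)" using k(1) h(1) kc hc closed by algebra
      also have "\<dots> \<in> I" by (rule I_add[OF k(3) h(3)])
      finally show "a \<otimes>\<^bsub>add_monoid R\<^esub> b \<in> T"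
        using k(1) h(1) F_add[OF k(2) h(2)] by (auto intro: mem[of _ "k \<oplus> h"])
    qed
    fix a r assume "a \<in> T" and r: "r \<in> carrier R"
    then obtain k where k: "a \<in> carrier R" "k \<in> F n" "a \<ominus> x \<otimes> k \<in> I" unfolding T_def by blast
    have kc: "k \<in> carrier R" using F_carr[OF k(2)] .
    have "r \<otimes> a \<ominus> x \<otimes> (r \<otimes> k) = r \<otimes> (a \<ominus> x \<otimes> k)" using k(1) kc r closed by algebra
    also have "\<dots> \<in> I" by (rule I_mult[OF k(3) r])
    finally show "r \<otimes> a \<in> T" using k(1) r F_mult[OF k(2) r] by (intro mem[of _ "r \<otimes> k"]) auto
    then show "a \<otimes> r \<in> T" using k(1) r m_comm by simp
  qed
  have "F (n + bound) \<subseteq> T"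
  proof (rule F_minimal[OF T])
    show "I \<subseteq> T"
    proof
      fix g assume g: "g \<in> I"
      then have "g \<ominus> x \<otimes> \<zero> \<in> I" using I_carr[OF g] by (simp add: a_minus_def)
      then show "g \<in> T" by (rule mem[OF I_carr[OF g] zero(2)])
    qed
    fix t assume t: "n + bound \<le> weight t"
    obtain i j l where e: "t = (i, j, l)" by (cases t) auto
    obtain i' j' l' where s: "step\<^sup>*\<^sup>* t (i', j', l')" "reduced j' l'" unfolding e using reduced_form_exists by blast
    have "j' * m2 \<le> c2 * m2" "l' * m3 \<le> c3 * m3"
      using s(2) unfolding reduced_def by (auto intro: mult_le_mono1)
    moreover have "i' * m1 + j' * m2 + l' * m3 = weight t" using steps_weight[OF s(1)] by simp
    ultimately have le: "n + m1 \<le> i' * m1" using t unfolding bound_def by linarith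
    then obtain i'' where i: "i' = Suc i''" using m_pos(1) by (cases i') auto
    have "mon t \<ominus> x \<otimes> mon (i'', j', l') \<in> I" using steps_congruent[OF s(1)] unfolding i x_mon .
    moreover have "mon (i'', j', l') \<in> F n" using le by (intro mon_in_F) (simp add: i)
    ultimately show "mon t \<in> T" by (rule mem[OF mon_closed, rotated])
  qed
  then show ?thesis using assms unfolding T_def by blast
qed

end

section \<open>Primality\<close>

locale hn_ideal_coprime = hn_ideal + hn_exponents_coprime
begin

text \<open>The graded pieces of \<open>R / I\<close> are at most one-dimensional, as monomials of equal weight are congruent
modulo \<open>I\<close>.\<close>

lemma F_decomposition:
  assumes f: "f \<in> F n" "f \<notin> F (Suc n)"
  shows "\<exists>i j l g r. reduced j l \<and> weight (i, j, l) = n \<and> g \<in> F (Suc n) \<and> r \<in> carrier R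
    \<and> f = g \<oplus> r \<otimes> mon (i, j, l)"
proof (cases "\<exists>t. weight t = n")
  case False
  have "F n \<subseteq> F (Suc n)"
  proof (intro F_minimal F_ideal I_subset_F mon_in_F)
    fix t assume "n \<le> weight t"
    then show "Suc n \<le> weight t" using False by (metis Suc_leI le_neq_implies_less)
  qed
  then show ?thesis using f by blast
next
  case True
  then obtain i0 j0 l0 where t0: "weight (i0, j0, l0) = n" by (metis prod_cases3)
  obtain i j l where n: "step\<^sup>*\<^sup>* (i0, j0, l0) (i, j, l)" "reduced j l" using reduced_form_exists by blast
  have w: "weight (i, j, l) = n" using steps_weight[OF n(1)] t0 by simp
  let ?A = "adjoin R (F (Suc n)) (mon (i, j, l))"
  have A: "ideal ?A R" by (intro adjoin_ideal F_ideal mon_closed)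
  have sub: "F (Suc n) \<subseteq> ?A" by (intro adjoin_superset F_ideal mon_closed)
  have "F n \<subseteq> ?A"
  proof (rule F_minimal[OF A])
    show "I \<subseteq> ?A" using I_subset_F sub by blast
    fix s assume s: "n \<le> weight s"
    show "mon s \<in> ?A"
    proof (cases "weight s = n")
      case True
      obtain i1 j1 l1 where e: "s = (i1, j1, l1)" by (cases s) auto
      obtain i' j' l' where n': "step\<^sup>*\<^sup>* s (i', j', l')" "reduced j' l'"
        unfolding e using reduced_form_exists by blast
      have "(i', j', l') = (i, j, l)"
        using steps_weight[OF n'(1)] True w by (intro reduced_weight_unique n(2) n'(2)) simp
      then have "mon s \<ominus> \<one> \<otimes> mon (i, j, l) \<in> F (Suc n)"
        using steps_congruent[OF n'(1)] I_subset_F[of "Suc n"] by auto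
      then show ?thesis by (intro adjoin_diffI[of _ _ \<one>] F_ideal mon_closed one_closed)
    next
      case False
      then show ?thesis using s mon_in_F[of "Suc n" s] sub by auto
    qed
  qed
  then have "f \<in> ?A" using f by blast
  then obtain g r where "g \<in> F (Suc n)" "r \<in> carrier R" "f = g \<oplus> r \<otimes> mon (i, j, l)" by (rule adjoinE)
  then show ?thesis using n(2) w by blast
qed

text \<open>Multiplication by \<open>x\<close> shifts the filtration exactly. Elements \<open>h \<in> F (n - m1)\<close> are found with
\<open>x (f - h)\<close> deeper and deeper in the filtration: if the leading monomial contains \<open>x\<close>, it can
be absorbed into \<open>x h\<close>; if it is some \<open>y^j z^l\<close>, its coefficient cannot be a unit by
\<open>F_reduced_yz\<close>. Deep enough, \<open>F_deep\<close> turns the error into \<open>x k\<close> modulo \<open>I\<close>, and \<open>x\<close> is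
regular modulo \<open>I\<close>.\<close>

lemma F_colon_x:
  assumes f: "f \<in> carrier R" and xf: "x \<otimes> f \<in> F n" shows "f \<in> F (n - m1)"
proof -
  have approx: "\<exists>h\<in>F (n - m1). x \<otimes> (f \<ominus> h) \<in> F (n + d)" for d
  proof (induction d)
    case 0
    have "f \<ominus> \<zero> = f" using f by algebra
    then show ?case using xf F_ideal[of "n - m1"]
      by (intro bexI[of _ \<zero>]) (simp_all add: additive_subgroup.zero_closed ideal.axioms(1))
  next
    case (Suc d)
    then obtain h where h: "h \<in> F (n - m1)" "x \<otimes> (f \<ominus> h) \<in> F (n + d)" by blast
    have hc: "h \<in> carrier R" using F_carr[OF h(1)] .
    show ?case
    proof (cases "x \<otimes> (f \<ominus> h) \<in> F (Suc (n + d))")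
      case True
      then show ?thesis using h(1) by auto
    next
      case False
      obtain i j l g r where t: "reduced j l" "weight (i, j, l) = n + d" and g: "g \<in> F (Suc (n + d))"
        and r: "r \<in> carrier R" and eq: "x \<otimes> (f \<ominus> h) = g \<oplus> r \<otimes> mon (i, j, l)"
        using F_decomposition[OF h(2) False] by blast
      have gc: "g \<in> carrier R" using F_carr[OF g] .
      show ?thesis
      proof (cases i)
        \<comment> \<open>The leading term is divisible by \<open>x\<close> and moves into \<open>h\<close>.\<close>
        case (Suc i')
        let ?u = "mon (i', j, l)"
        have "x \<otimes> (f \<ominus> (h \<oplus> r \<otimes> ?u)) = x \<otimes> (f \<ominus> h) \<ominus> r \<otimes> (x \<otimes> ?u)"
          using f hc r mon_closed closed by algebra
        also have "\<dots> = g" unfolding eq x_mon Suc using gc r mon_closed by algebra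
        finally have "x \<otimes> (f \<ominus> (h \<oplus> r \<otimes> ?u)) \<in> F (n + Suc d)" using g by simp
        moreover have "?u \<in> F (n - m1)" using t(2) by (intro mon_in_F) (simp add: Suc)
        then have "h \<oplus> r \<otimes> ?u \<in> F (n - m1)" by (intro F_add h(1) F_mult r)
        ultimately show ?thesis by blast
      next
        case 0
        let ?u = "mon (0, j, l)"
        note B = F_reduced_yz[OF t(1), of "Suc (n + d)"]
        let ?B = "adjoin R (adjoin R (PIdl x) (y [^] Suc j)) (z [^] Suc l)"
        have lt: "weight (0, j, l) < Suc (n + d)" using t(2) 0 by simp
        have "r \<in> \<mm>"
        proof (rule ccontr)
          \<comment> \<open>A unit coefficient would put \<open>y^j z^l\<close> into \<open>(x) + F (n + d + 1)\<close>.\<close>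
          assume nr: "r \<notin> \<mm>"
          have "r \<otimes> ?u = (f \<ominus> h) \<otimes> x \<ominus> g"
          proof -
            have "(f \<ominus> h) \<otimes> x \<ominus> g = (g \<oplus> r \<otimes> ?u) \<ominus> g"
              using eq f hc m_comm[of "f \<ominus> h" x] unfolding 0 by simp
            also have "\<dots> = r \<otimes> ?u" using gc r mon_closed by algebra
            finally show ?thesis by simp
          qed
          moreover have "(f \<ominus> h) \<otimes> x \<in> ?B" using B(3)[OF lt] f hc cgenidealI[of "f \<ominus> h" x] by blast
          then have "(f \<ominus> h) \<otimes> x \<ominus> g \<in> ?B" 
            using B(1)[OF lt] g by (intro ideal_minus_closed B(4) lt) auto
          ultimately have "r \<otimes> ?u \<in> ?B" by simp
          then have "?u \<in> ?B" using saturatedD[OF saturated_max[OF B(4)[OF lt]] r nr mon_closed] by blast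
          then show False using B(2)[OF lt] by (simp add: mon.simps)
        qed
        then have "r \<otimes> ?u \<in> F (n + Suc d)" using max_mult_mon[of r "(0, j, l)"] t(2) 0 by simp
        then have "x \<otimes> (f \<ominus> h) \<in> F (n + Suc d)" using g unfolding eq 0 by (intro F_add) simp_all
        then show ?thesis using h(1) by blast
      qed
    qed
  qed
  obtain h where h: "h \<in> F (n - m1)" "x \<otimes> (f \<ominus> h) \<in> F (n + bound)" using approx by blast
  have hc: "h \<in> carrier R" using F_carr[OF h(1)] .
  obtain k where k: "k \<in> F n" "x \<otimes> (f \<ominus> h) \<ominus> x \<otimes> k \<in> I" using F_deep[OF h(2)] by blast
  have kc: "k \<in> carrier R" using F_carr[OF k(1)] .
  have "x \<otimes> (f \<ominus> h \<ominus> k) = x \<otimes> (f \<ominus> h) \<ominus> x \<otimes> k" using f hc kc closed by algebra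
  then have "f \<ominus> h \<ominus> k \<in> I" using k(2) f hc kc by - (rule I_x_regular, simp_all)
  then have "(f \<ominus> h \<ominus> k) \<oplus> h \<oplus> k \<in> F (n - m1)"
    using I_subset_F h(1) k(1) F_antimono[of "n - m1" n] by (intro F_add) auto
  moreover have "(f \<ominus> h \<ominus> k) \<oplus> h \<oplus> k = f" using f hc kc by algebra
  ultimately show ?thesis by simp
qed

text \<open>The powers of \<open>x\<close> are removed one by one, down to \<open>y^j z^l\<close>.\<close>

lemma reduced_mon_not_in_F: "reduced j l \<Longrightarrow> n > weight (i, j, l) \<Longrightarrow> mon (i, j, l) \<notin> F n"
proof (induction i arbitrary: n)
  case 0
  then show ?case using F_reduced_yz(1,2)[OF 0] by (auto simp: mon.simps)
next
  case (Suc i)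
  show ?case
  proof
    assume "mon (Suc i, j, l) \<in> F n"
    then have "mon (i, j, l) \<in> F (n - m1)" unfolding x_mon[symmetric] by (rule F_colon_x[OF mon_closed])
    moreover have "weight (i, j, l) < n - m1" using Suc.prems(2) by simp
    ultimately show False using Suc.IH[OF Suc.prems(1)] by blast
  qed
qed

lemma mon_not_in_F: assumes "n > weight t" shows "mon t \<notin> F n"
proof
  assume m: "mon t \<in> F n"
  obtain i0 j0 l0 where e: "t = (i0, j0, l0)" by (cases t) auto
  obtain i j l where s: "step\<^sup>*\<^sup>* t (i, j, l)" "reduced j l" unfolding e using reduced_form_exists by blast
  have "mon t \<ominus> (mon t \<ominus> mon (i, j, l)) \<in> F n"
    by (rule F_minus[OF m subsetD[OF I_subset_F steps_congruent[OF s(1)]]])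
  moreover have "mon t \<ominus> (mon t \<ominus> mon (i, j, l)) = mon (i, j, l)" using mon_closed by algebra
  ultimately show False using reduced_mon_not_in_F[OF s(2)] steps_weight[OF s(1)] assms by auto
qed

text \<open>Krull's intersection theorem in this setting: by \<open>F_deep\<close> and \<open>F_colon_x\<close>, the intersection \<open>T\<close>
satisfies \<open>T \<subseteq> I + x T\<close>.\<close>

lemma F_separated: "(\<Inter>n. F n) = I"
proof
  show "I \<subseteq> (\<Inter>n. F n)" using I_subset_F by blast
  have T: "ideal (\<Inter>n. F n) R" using F_ideal by (intro i_Intersect) auto
  show "(\<Inter>n. F n) \<subseteq> I"
  proof (rule nakayama[OF T I_ideal])
    fix r assume r: "r \<in> (\<Inter>n. F n)"
    then obtain k where k: "k \<in> F 0" "r \<ominus> x \<otimes> k \<in> I" using F_deep[of r 0] by auto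
    have c: "k \<in> carrier R" "r \<in> carrier R" using F_carr[OF k(1)] r F_carr by auto
    have "k \<in> F n" for n
    proof -
      have "r \<ominus> (r \<ominus> x \<otimes> k) \<in> F (n + m1)" 
        using r by (intro F_minus[OF _ subsetD[OF I_subset_F k(2)]]) auto
      moreover have "r \<ominus> (r \<ominus> x \<otimes> k) = x \<otimes> k" using c closed by algebra
      ultimately show ?thesis using F_colon_x[OF c(1), of "n + m1"] by simp
    qed
    moreover have "r = (r \<ominus> x \<otimes> k) \<oplus> x \<otimes> k" using c closed by algebra
    ultimately show "\<exists>g\<in>I. \<exists>q\<in>\<mm>. \<exists>m\<in>\<Inter>n. F n. r = g \<oplus> q \<otimes> m" using k(2) max_mem(1) by blast
  qed
qed

lemma leading_monomial:
  assumes "f \<in> carrier R" "f \<notin> I"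
  obtains n t g r where "weight t = n" "g \<in> F (Suc n)" "r \<in> carrier R" "r \<notin> \<mm>" "f = g \<oplus> r \<otimes> mon t"
proof -
  have "\<exists>n. f \<in> F n \<and> f \<notin> F (Suc n)"
  proof (rule ccontr)
    assume "\<not> ?thesis"
    then have "f \<in> F n" for n using assms(1) F_0 by (induction n) auto
    then show False using assms(2) F_separated by blast
  qed
  then obtain n where n: "f \<in> F n" "f \<notin> F (Suc n)" by blast
  obtain i j l g r where t: "weight (i, j, l) = n" "g \<in> F (Suc n)" "r \<in> carrier R" "f = g \<oplus> r \<otimes> mon (i, j, l)"
    using F_decomposition[OF n] by blast
  have "r \<notin> \<mm>"
  proof
    assume "r \<in> \<mm>"
    then have "r \<otimes> mon (i, j, l) \<in> F (Suc n)" using max_mult_mon[of r "(i, j, l)"] t(1) by simp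
    then have "f \<in> F (Suc n)" unfolding t(4) by (rule F_add[OF t(2)])
    then show False using n(2) by simp
  qed
  then show thesis using that t by blast
qed

text \<open>If \<open>f\<close> and \<open>g\<close> have unit multiples of monomials as leading terms, then so has \<open>f g\<close>.\<close>

theorem I_prime: "primeideal I R"
proof (rule primeidealI[OF I_ideal is_cring])
  have "mon (0, 0, 0) \<notin> F 1" by (rule mon_not_in_F) simp
  then have "\<one> \<notin> I" using I_subset_F[of 1] by (auto simp: mon.simps)
  then show "carrier R \<noteq> I" by auto
  fix f g assume f: "f \<in> carrier R" and g: "g \<in> carrier R" and fg: "f \<otimes> g \<in> I"
  show "f \<in> I \<or> g \<in> I"
  proof (rule ccontr)
    assume "\<not> ?thesis"
    then have nf: "f \<notin> I" and ng: "g \<notin> I" by auto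
    obtain n t f' r where t: "weight t = n" "f' \<in> F (Suc n)" "r \<in> carrier R" "r \<notin> \<mm>" "f = f' \<oplus> r \<otimes> mon t"
      using leading_monomial[OF f nf] .
    obtain k s g' q where s: "weight s = k" "g' \<in> F (Suc k)" "q \<in> carrier R" "q \<notin> \<mm>" "g = g' \<oplus> q \<otimes> mon s"
      using leading_monomial[OF g ng] .
    have c: "f' \<in> carrier R" "g' \<in> carrier R" using F_carr t(2) s(2) by auto
    obtain i j l i' j' l' where e: "t = (i, j, l)" "s = (i', j', l')" by (cases t, cases s) auto
    let ?u = "mon (i + i', j + j', l + l')"
    have "(r \<otimes> q) \<otimes> (mon t \<otimes> mon s) = (f' \<oplus> r \<otimes> mon t) \<otimes> (g' \<oplus> q \<otimes> mon s) 
        \<ominus> f' \<otimes> (g' \<oplus> q \<otimes> mon s) \<ominus> r \<otimes> (g' \<otimes> mon t)"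
      using c t(3) s(3) mon_closed by algebra
    also have "\<dots> = f \<otimes> g \<ominus> f' \<otimes> g \<ominus> r \<otimes> (g' \<otimes> mon t)" unfolding t(5) s(5) ..
    also have "\<dots> \<in> F (Suc (n + k))"
    proof (rule F_minus[OF F_minus F_mult[OF _ t(3)]])
      show "f \<otimes> g \<in> F (Suc (n + k))" using fg I_subset_F by blast
      have "g \<in> F k"
        unfolding s(5) using s(1,2,3) F_antimono[of k "Suc k"] by (intro F_add F_mult mon_in_F) auto
      then show "f' \<otimes> g \<in> F (Suc (n + k))" using F_mult_F[OF t(2)] by fastforce
      show "g' \<otimes> mon t \<in> F (Suc (n + k))" using F_mono_mult[OF s(2), of t] t(1) by (simp add: add.commute)
    qed
    finally have "(r \<otimes> q) \<otimes> ?u \<in> F (Suc (n + k))" unfolding e mon_mult .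
    moreover have "r \<otimes> q \<in> carrier R - \<mm>" using prime_not_mult[OF max_prime] t(3,4) s(3,4) by simp
    ultimately have "?u \<in> F (Suc (n + k))"
      using saturatedD[OF saturated_max[OF F_ideal]] mon_closed by (metis DiffE)
    moreover have "?u \<notin> F (Suc (n + k))"
      using t(1) s(1) by (intro mon_not_in_F) (simp add: e algebra_simps)
    ultimately show False by blast
  qed
qed

end

section \<open>Minimal generators and the Shimoda property\<close>

lemma min_gens_le_attained:
  assumes "min_gens R I \<le> enat n"
  shows "\<exists>A\<subseteq>carrier R. finite A \<and> I = Idl\<^bsub>R\<^esub> A \<and> card A \<le> n"
proof (rule ccontr)
  assume none: "\<not> ?thesis"
  have "enat (Suc n) \<le> min_gens R I"
    unfolding min_gens_def
  proof (rule Inf_greatest)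
    fix k assume "k \<in> {enat (card A) | A. A \<subseteq> carrier R \<and> finite A \<and> I = Idl\<^bsub>R\<^esub> A}"
    then obtain A where "k = enat (card A)" "A \<subseteq> carrier R" "finite A" "I = Idl\<^bsub>R\<^esub> A" by blast
    then show "enat (Suc n) \<le> k" using none by (metis Suc_leI enat_ord_simps(1) linorder_not_le)
  qed
  then have "enat (Suc n) \<le> enat n" using assms by (rule order_trans)
  then show False by simp
qed

text \<open>The element \<open>a\<close> fills up when \<open>A\<close> is empty.\<close>

lemma card_le_2_subset_pair:
  assumes "finite A" "card A \<le> 2" shows "\<exists>f g. A \<subseteq> {f, g} \<and> {f, g} \<subseteq> insert a A"
proof -
  consider "card A = 0" | "card A = 1" | "card A = 2" using assms(2) by linarith
  then show ?thesis
  proof cases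
    case 1
    then have "A \<subseteq> {a, a}" "{a, a} \<subseteq> insert a A" using assms(1) by simp_all
    then show ?thesis by blast
  next
    case 2
    then obtain f where "A = {f}" by (rule card_1_singletonE)
    then have "A \<subseteq> {f, f}" "{f, f} \<subseteq> insert a A" by auto
    then show ?thesis by blast
  next
    case 3
    then obtain f g where "A = {f, g}" by (auto simp: card_2_iff)
    then have "A \<subseteq> {f, g}" "{f, g} \<subseteq> insert a A" by auto
    then show ?thesis by blast
  qed
qed

context hn_ideal
begin

lemma max_mult_closed: "q \<in> \<mm> \<Longrightarrow> r \<in> carrier R \<Longrightarrow> q \<otimes> r \<in> \<mm>"
  by (rule ideal.I_r_closed[OF max_ideal])

text \<open>The generators are linearly independent modulo \<open>\<mm> I\<close>. Two summands on the right-hand side suffice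
for an ideal with two generators.\<close>

lemma generators_independent_mod_max:
  assumes r: "r1 \<in> carrier R" "r2 \<in> carrier R" "r3 \<in> carrier R"
    and t: "t \<in> \<mm>" "t' \<in> \<mm>" and h: "h \<in> I" "h' \<in> I"
    and rel: "r1 \<otimes> v1 \<oplus> r2 \<otimes> v2 \<oplus> r3 \<otimes> D = t \<otimes> h \<oplus> t' \<otimes> h'"
  shows "r1 \<in> \<mm>" "r2 \<in> \<mm>" "r3 \<in> \<mm>"
proof -
  obtain p1 p2 p3 where p: "p1 \<in> carrier R" "p2 \<in> carrier R" "p3 \<in> carrier R"
    and hp: "h = p1 \<otimes> v1 \<oplus> p2 \<otimes> v2 \<oplus> p3 \<otimes> D" using h(1) by (rule I_memE)
  obtain q1 q2 q3 where q: "q1 \<in> carrier R" "q2 \<in> carrier R" "q3 \<in> carrier R"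
    and hq: "h' = q1 \<otimes> v1 \<oplus> q2 \<otimes> v2 \<oplus> q3 \<otimes> D" using h(2) by (rule I_memE)
  have tc: "t \<in> carrier R" "t' \<in> carrier R" using t max_subset_carrier by auto
  have hc: "h \<in> carrier R" "h' \<in> carrier R" using h I_carr by auto
  define s1 s2 s3 where s: "s1 = t \<otimes> p1 \<oplus> t' \<otimes> q1" "s2 = t \<otimes> p2 \<oplus> t' \<otimes> q2" "s3 = t \<otimes> p3 \<oplus> t' \<otimes> q3"
  have sm: "s1 \<in> \<mm>" "s2 \<in> \<mm>" "s3 \<in> \<mm>"
    unfolding s using p q t by (auto intro!: ideal_add_closed[OF max_ideal] max_mult_closed)
  have sc: "s1 \<in> carrier R" "s2 \<in> carrier R" "s3 \<in> carrier R" using sm max_subset_carrier by auto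
  have th: "t \<otimes> h \<oplus> t' \<otimes> h' = s1 \<otimes> v1 \<oplus> s2 \<otimes> v2 \<oplus> s3 \<otimes> D"
    unfolding hp hq s using p q tc v_closed by algebra
  have "(r1 \<ominus> s1) \<otimes> v1 \<oplus> (r2 \<ominus> s2) \<otimes> v2 \<oplus> (r3 \<ominus> s3) \<otimes> D
    = (r1 \<otimes> v1 \<oplus> r2 \<otimes> v2 \<oplus> r3 \<otimes> D) \<ominus> (s1 \<otimes> v1 \<oplus> s2 \<otimes> v2 \<oplus> s3 \<otimes> D)"
    using r sc v_closed by algebra
  also have "\<dots> = \<zero>" unfolding rel th using sc by (simp add: a_minus_def r_neg)
  finally have *: "(r1 \<ominus> s1) \<otimes> v1 \<oplus> (r2 \<ominus> s2) \<otimes> v2 \<oplus> (r3 \<ominus> s3) \<otimes> D = \<zero>" .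
  have m: "r1 \<ominus> s1 \<in> \<mm>" "r2 \<ominus> s2 \<in> \<mm>" "r3 \<ominus> s3 \<in> \<mm>"
    using I_syzygy_in_max[OF _ _ _ *] r sc by simp_all
  have conclude: "r \<in> \<mm>" if "r \<ominus> s \<in> \<mm>" "s \<in> \<mm>" "r \<in> carrier R" "s \<in> carrier R" for r s
  proof -
    have "(r \<ominus> s) \<oplus> s = r" using that(3,4) by algebra
    then show ?thesis using ideal_add_closed[OF max_ideal that(1,2)] by simp
  qed
  show "r1 \<in> \<mm>" by (rule conclude[OF m(1) sm(1) r(1) sc(1)])
  show "r2 \<in> \<mm>" by (rule conclude[OF m(2) sm(2) r(2) sc(2)])
  show "r3 \<in> \<mm>" by (rule conclude[OF m(3) sm(3) r(3) sc(3)])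
qed

text \<open>Let \<open>v_i = p_i f + q_i g\<close>. The cross product of the vectors \<open>p\<close> and \<open>q\<close> is a syzygy, so its entries
lie in \<open>\<mm>\<close>. Eliminating \<open>f\<close> or \<open>g\<close> from two of the equations shows \<open>p1, q1 \<in> \<mm>\<close>. Then \<open>v1\<close>
itself lies in \<open>\<mm> I\<close>, which contradicts independence.\<close>

lemma I_not_two_generated:
  assumes A: "A \<subseteq> carrier R" "finite A" "card A \<le> 2" shows "I \<noteq> Idl A"
proof
  assume IA: "I = Idl A"
  obtain f g where fg: "A \<subseteq> {f, g}" "{f, g} \<subseteq> insert \<zero> A"
    using card_le_2_subset_pair[OF A(2,3), of "\<zero>"] by blast
  have "A \<subseteq> I" unfolding IA by (rule genideal_self[OF A(1)])
  moreover have "\<zero> \<in> I" by (rule additive_subgroup.zero_closed[OF ideal.axioms(1)[OF I_ideal]])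
  ultimately have fgI: "f \<in> I" "g \<in> I" using fg(2) by auto
  have c: "f \<in> carrier R" "g \<in> carrier R" using fgI I_carr by auto
  have gI: "ideal (PIdl g) R" by (rule cgenideal_ideal[OF c(2)])
  have "A \<subseteq> adjoin R (PIdl g) f"
    using fg(1) adjoin_self[OF gI c(1)] adjoin_superset[OF gI c(1)] cgenideal_self[OF c(2)] by blast
  then have sub: "I \<subseteq> adjoin R (PIdl g) f" unfolding IA by (rule genideal_minimal[OF adjoin_ideal[OF gI c(1)]])
  have repr: "\<exists>p\<in>carrier R. \<exists>q\<in>carrier R. v = p \<otimes> f \<oplus> q \<otimes> g" if v: "v \<in> I" for v
  proof -
    have "v \<in> adjoin R (PIdl g) f" using sub v by blast
    then obtain k p where k: "k \<in> PIdl g" "p \<in> carrier R" "v = k \<oplus> p \<otimes> f" by (rule adjoinE)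
    obtain q where q: "q \<in> carrier R" "k = q \<otimes> g" using k(1) by (rule cgenidealE)
    have "v = p \<otimes> f \<oplus> q \<otimes> g" unfolding k(3) q(2) using k(2) q(1) c by algebra
    then show ?thesis using k(2) q(1) by blast
  qed
  obtain p1 q1 where 1: "p1 \<in> carrier R" "q1 \<in> carrier R" "v1 = p1 \<otimes> f \<oplus> q1 \<otimes> g" using repr[OF v_in_I(1)] by blast
  obtain p2 q2 where 2: "p2 \<in> carrier R" "q2 \<in> carrier R" "v2 = p2 \<otimes> f \<oplus> q2 \<otimes> g" using repr[OF v_in_I(2)] by blast
  obtain p3 q3 where 3: "p3 \<in> carrier R" "q3 \<in> carrier R" "D = p3 \<otimes> f \<oplus> q3 \<otimes> g" using repr[OF v_in_I(3)] by blast
  note pq = 1(1,2) 2(1,2) 3(1,2)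
  let ?\<gamma> = "p1 \<otimes> q2 \<ominus> p2 \<otimes> q1"
  define \<alpha> \<beta> where ab: "\<alpha> = p2 \<otimes> q3 \<ominus> p3 \<otimes> q2" "\<beta> = p3 \<otimes> q1 \<ominus> p1 \<otimes> q3"
  have abc: "\<alpha> \<in> carrier R" "\<beta> \<in> carrier R" "?\<gamma> \<in> carrier R" unfolding ab using pq by auto
  have orth: "\<alpha> \<otimes> p1 \<oplus> \<beta> \<otimes> p2 \<oplus> ?\<gamma> \<otimes> p3 = \<zero>" "\<alpha> \<otimes> q1 \<oplus> \<beta> \<otimes> q2 \<oplus> ?\<gamma> \<otimes> q3 = \<zero>"
    unfolding ab using pq by algebra+
  \<comment> \<open>The cross product is orthogonal to both coefficient vectors, so it is a syzygy.\<close>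
  have "\<alpha> \<otimes> v1 \<oplus> \<beta> \<otimes> v2 \<oplus> ?\<gamma> \<otimes> D
      = (\<alpha> \<otimes> p1 \<oplus> \<beta> \<otimes> p2 \<oplus> ?\<gamma> \<otimes> p3) \<otimes> f \<oplus> (\<alpha> \<otimes> q1 \<oplus> \<beta> \<otimes> q2 \<oplus> ?\<gamma> \<otimes> q3) \<otimes> g"
    unfolding 1(3) 2(3) 3(3) using abc pq c by algebra
  also have "\<dots> = \<zero>" unfolding orth using c by simp
  finally have \<gamma>: "?\<gamma> \<in> \<mm>" by (rule I_syzygy_in_max(3)[OF abc])
  have zm: "\<zero> \<in> \<mm>" by (rule additive_subgroup.zero_closed[OF ideal.axioms(1)[OF max_ideal]])
  have e1: "\<ominus> p2 \<otimes> v1 \<oplus> p1 \<otimes> v2 \<oplus> \<zero> \<otimes> D = ?\<gamma> \<otimes> g \<oplus> \<zero> \<otimes> g"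
    unfolding 1(3) 2(3) 3(3) using pq c by algebra
  have p1: "p1 \<in> \<mm>"
    by (rule generators_independent_mod_max(2)[OF a_inv_closed[OF pq(3)] pq(1) zero_closed \<gamma> zm fgI(2,2) e1])
  have e2: "q2 \<otimes> v1 \<oplus> \<ominus> q1 \<otimes> v2 \<oplus> \<zero> \<otimes> D = ?\<gamma> \<otimes> f \<oplus> \<zero> \<otimes> f"
    unfolding 1(3) 2(3) 3(3) using pq c by algebra
  have "\<ominus> q1 \<in> \<mm>"
    by (rule generators_independent_mod_max(2)[OF pq(4) a_inv_closed[OF pq(2)] zero_closed \<gamma> zm fgI(1,1) e2])
  then have q1: "q1 \<in> \<mm>"
    using additive_subgroup.a_inv_closed[OF ideal.axioms(1)[OF max_ideal], of "\<ominus> q1"] pq by simp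
  have e3: "\<one> \<otimes> v1 \<oplus> \<zero> \<otimes> v2 \<oplus> \<zero> \<otimes> D = p1 \<otimes> f \<oplus> q1 \<otimes> g"
    unfolding 1(3)[symmetric] using v_closed by algebra
  have "\<one> \<in> \<mm>"
    by (rule generators_independent_mod_max(1)[OF one_closed zero_closed zero_closed p1 q1 fgI e3])
  then show False using prime_one_not[OF max_prime] by simp
qed

end

lemma (in hn_ideal_coprime) I_ne_max: "I \<noteq> \<mm>"
proof -
  have "mon (1, 0, 0) \<notin> F (Suc m1)" by (rule mon_not_in_F) simp
  then have "x \<notin> I" using I_subset_F[of "Suc m1"] by (auto simp: mon.simps)
  then show ?thesis using max_mem(1) by blast
qed

theorem proposition2p6:
  fixes R :: "('a, 'b) ring_scheme" and \<mm> :: "'a set"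
    and x1 x2 x3 :: 'a and a1 a2 a3 b1 b2 b3 :: nat
  assumes "regular_local_ring R \<mm>"
    and "krull_dim R = 3"
    and "noetherian_local_ring.regular_system_of_parameters R \<mm> [x1, x2, x3]"
    and "a1 > 0" "a2 > 0" "a3 > 0" "b1 > 0" "b2 > 0" "b3 > 0"
  shows "((let (m1, m2, m3) = HN_m (a1, a2, a3) (b1, b2, b3) in gcd m1 (gcd m2 m3) = 1)
           \<longrightarrow> primeideal (HN_ideal R (x1, x2, x3) (a1, a2, a3) (b1, b2, b3)) R)
         \<and> \<not> shimoda_ring R \<mm>"
proof (intro conjI impI notI)
  interpret regular_local_ring R \<mm> by fact
  have "x1 \<in> carrier R" "x2 \<in> carrier R" "x3 \<in> carrier R" "Idl\<^bsub>R\<^esub> {x1, x2, x3} = \<mm>"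
    using assms(3) unfolding regular_system_of_parameters_def by auto
  then interpret regular_triple R \<mm> x1 x2 x3
    using assms(2) by (rule regular_triple_if_krull_dim_3)
  {
    assume gcd: "let (m1, m2, m3) = HN_m (a1, a2, a3) (b1, b2, b3) in gcd m1 (gcd m2 m3) = 1"
    interpret hn_exponents a1 a2 a3 b1 b2 b3 by unfold_locales fact+
    interpret hn_ideal_coprime R \<mm> x1 x2 x3 a1 a2 a3 b1 b2 b3
      using gcd unfolding HN_m_eq by unfold_locales simp
    show "primeideal (HN_ideal R (x1, x2, x3) (a1, a2, a3) (b1, b2, b3)) R"
      using I_prime unfolding I_eq_HN_ideal .
  }
  assume "shimoda_ring R \<mm>"
  then interpret shimoda_ring R \<mm> .
  \<comment> \<open>The monomial curve with parametrization \<open>(t^3, t^4, t^5)\<close> is the witness.\<close>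
  interpret hn_exponents 1 1 1 2 1 1 by unfold_locales simp_all
  have "m1 = 3" "m2 = 4" "m3 = 5" unfolding m1_def m2_def m3_def by simp_all
  then have "gcd m1 (gcd m2 m3) = gcd 3 (gcd 4 5)" by (simp only:)
  also have "\<dots> = 1" by (simp add: gcd_non_0_nat)
  finally interpret hn_ideal_coprime R \<mm> x1 x2 x3 1 1 1 2 1 1 by unfold_locales
  have "min_gens R I = ideal_height R I" by (rule min_gens_eq_height[OF I_prime I_ne_max])
  also have "\<dots> \<le> enat 2"
    using assms(2) by (intro ideal_height_less_krull_dim I_prime I_ne_max) (simp add: numeral_eq_enat)
  finally show False using min_gens_le_attained[of R I 2] I_not_two_generated by blast
qed

end
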